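(* For all integers $n\ge1$ and $a,b\ge 0$ there exists a bijection $\psi:\overline{\mathcal D}_n^{(a,b)}\to\overline{\mathcal D}_n^{(b,a)}$ such that for every $D\in\overline{\mathcal D}_n^{(a,b)}$ we have $\mathsf{area}(D)=\mathsf{area}(\psi(D))$ and $\mathsf{bounce}'(D)=\mathsf{bounce}'(\psi(D))$.
   Context: A Dyck path of size $n$ is a lattice path from $(0,0)$ to $(n,n)$ with unit north and east steps staying weakly above $y=x$. Its $i$-th north step lies in row $i$ (between heights $i-1$ and $i$); the area word $w_1(D)\cdots w_n(D)$ records the number $w_i(D)$ of whole unit squares in row $i$ between the path and $y=x$. A peak is a north step followed by an east step; a rise is a north step followed by a north step. $\mathcal D_n^{(a,b)}$ is the set of Dyck paths of size $n$ with a choice of $a$ decorated peaks and $b$ decorated rises; $\mathsf{Peak}(D)$, $\mathsf{Rise}(D)$ are the sets of indices $i$ such that the $i$-th north step is a decorated peak, resp. rise. $\mathsf{area}(D)=\sum_i w_i(D)-\sum_{j\in\mathsf{Rise}(D)}w_{j+1}(D)$. Second bounce: let $p_i$ be the number of elements of $\mathsf{Peak}(D)$ smaller than $i$; delete every east step immediately following a decorated peak and translate later steps left to get a connected path $\bar D$ from $(0,0)$ to $(n-a,n)$; the modified diagonal is the union over $i$ of the segments from $(i-1-p_i,i-1)$ to $(i-p_i,i)$. The second bounce path starts at $(0,0)$, goes north until it reaches the starting point of an east step of $\bar D$, then east until it meets the modified diagonal, then north, etc., until $(n-a,n)$; its north steps are labelled $0$ before its first north-to-east turn, $1$ between the first and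 second turns, etc.; $\mathsf{bounce}'(D)$ is the sum of all these labels. $\overline{\mathcal D}_n^{(a,b)}\subseteq\mathcal D_n^{(a,b)}$ consists of the elements whose last peak (the peak in row $n$) is not decorated. *)

theory Defs
  imports "HOL-Analysis.Analysis"
begin

datatype step = North | East

definition dyck_path :: "nat \<Rightarrow> step list \<Rightarrow> bool" where
  "dyck_path n p \<longleftrightarrow>
     count_list p North = n \<and> count_list p East = n \<and>
     (\<forall>k \<le> length p. count_list (take k p) East \<le> count_list (take k p) North)"

text \<open>
  List positions are counted from 0, whereas north steps (equivalently rows) are counted from 1:
  \<open>is_north_step p i k\<close> says that the \<open>i\<close>-th north step of \<open>p\<close> is the list entry \<open>p ! k\<close>.
\<close>
definition is_north_step :: "step list \<Rightarrow> nat \<Rightarrow> nat \<Rightarrow> bool" where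
  "is_north_step p i k \<longleftrightarrow>
     k < length p \<and> p ! k = North \<and> count_list (take (Suc k) p) North = i"

definition peaks :: "step list \<Rightarrow> nat set" where
  "peaks p = {i. \<exists>k. is_north_step p i k \<and> Suc k < length p \<and> p ! Suc k = East}"

definition rises :: "step list \<Rightarrow> nat set" where
  "rises p = {i. \<exists>k. is_north_step p i k \<and> Suc k < length p \<and> p ! Suc k = North}"

text \<open>
  The unit square with lower left corner \<open>(x, i - 1)\<close> lies to the right of the \<open>i\<close>-th north step
  iff \<open>x\<close> is at least the number of preceding east steps, and weakly above \<open>y = x\<close> iff its
  lower right corner \<open>(x + 1, i - 1)\<close> is.
\<close>
definition area_word :: "step list \<Rightarrow> nat \<Rightarrow> nat" where
  "area_word p i =
     card {x. \<exists>k. is_north_step p i k \<and> count_list (take k p) East \<le> x \<and> x + 1 \<le> i - 1}"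

record decorated_path =
  path :: "step list"
  Peak :: "nat set"
  Rise :: "nat set"

definition decorated_dyck :: "nat \<Rightarrow> nat \<Rightarrow> nat \<Rightarrow> decorated_path set" where
  "decorated_dyck n a b =
     {D. dyck_path n (path D) \<and>
         Peak D \<subseteq> peaks (path D) \<and> card (Peak D) = a \<and>
         Rise D \<subseteq> rises (path D) \<and> card (Rise D) = b}"

definition decorated_dyck_bar :: "nat \<Rightarrow> nat \<Rightarrow> nat \<Rightarrow> decorated_path set" where
  "decorated_dyck_bar n a b = {D \<in> decorated_dyck n a b. n \<notin> Peak D}"

definition size_of :: "decorated_path \<Rightarrow> nat" where
  "size_of D = count_list (path D) North"

definition area :: "decorated_path \<Rightarrow> int" where
  "area D = (\<Sum>i = 1..size_of D. int (area_word (path D) i))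
            - (\<Sum>j \<in> Rise D. int (area_word (path D) (j + 1)))"

definition reduced_path :: "decorated_path \<Rightarrow> step list" where
  "reduced_path D =
     nths (path D) {k. \<not> (\<exists>i \<in> Peak D. \<exists>j. is_north_step (path D) i j \<and> k = Suc j)}"

definition east_step_starts :: "step list \<Rightarrow> (nat \<times> nat) set" where
  "east_step_starts q =
     {(count_list (take k q) East, count_list (take k q) North) | k. k < length q \<and> q ! k = East}"

definition peaks_before :: "decorated_path \<Rightarrow> nat \<Rightarrow> nat" where
  "peaks_before D i = card {j \<in> Peak D. j < i}"

definition modified_diagonal :: "decorated_path \<Rightarrow> (real \<times> real) set" where
  "modified_diagonal D =
     (\<Union>i \<in> {1..size_of D}.
        closed_segment (real i - 1 - real (peaks_before D i), real i - 1)
                       (real i - real (peaks_before D i), real i))"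

definition bounce_end :: "decorated_path \<Rightarrow> nat \<times> nat" where
  "bounce_end D = (size_of D - card (Peak D), size_of D)"

text \<open>
  Height at which the second bounce path, travelling north from \<open>(x, y)\<close>, stops; and abscissa at
  which it stops when travelling east from \<open>(x, y)\<close>.  As \<open>y\<close> is an integer and the
  segments of the modified diagonal are diagonals of unit squares, the latter can only meet the
  modified diagonal in lattice points.
\<close>
definition north_stop :: "decorated_path \<Rightarrow> nat \<Rightarrow> nat \<Rightarrow> nat" where
  "north_stop D x y =
     (LEAST y'. y \<le> y' \<and> ((x, y') \<in> east_step_starts (reduced_path D) \<or> (x, y') = bounce_end D))"

definition east_stop :: "decorated_path \<Rightarrow> nat \<Rightarrow> nat \<Rightarrow> nat" where
  "east_stop D x y =
     (LEAST x'. x \<le> x' \<and> ((real x', real y) \<in> modified_diagonal D \<or> (x', y) = bounce_end D))"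

text \<open>
  \<open>bounce_point D k\<close> is the point at which the second bounce path begins its run of north steps
  labelled \<open>k\<close>; once \<open>bounce_end D\<close> is reached, the sequence stays there.
\<close>
fun bounce_point :: "decorated_path \<Rightarrow> nat \<Rightarrow> nat \<times> nat" where
  "bounce_point D 0 = (0, 0)"
| "bounce_point D (Suc k) =
     (let (x, y) = bounce_point D k; y' = north_stop D x y
      in (east_stop D x y', y'))"

text \<open>
  The inner sum runs over the rows of the north steps labelled \<open>k\<close>.  The path has at most
  \<open>size_of D\<close> runs of north steps, since each of them contains at least one of the
  \<open>size_of D\<close> north steps.
\<close>
definition second_bounce :: "decorated_path \<Rightarrow> nat" where
  "second_bounce D =
     (\<Sum>k < size_of D. \<Sum>r \<in> {snd (bounce_point D k)<..snd (bounce_point D (Suc k))}. k)"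

end

theory Submission
  imports Defs
begin

text \<open>
  A decorated path is the list of its rows, each recording its area and whether it carries a decorated
  peak or follows a decorated rise.  In this encoding the second bounce path reads off blocks of rows
  greedily, so the generating function by size, area, bounce and both kinds of decorations is computed
  by a transfer recursion, whose state at the end of a block is the number \<open>s\<close> of rows of that block
  without decorated peak.  Summing over a block with \<open>m\<close> rows that count for the area contributes a
  \<open>q\<close>-binomial coefficient in \<open>s + m\<close>.  The \<open>q\<close>-Vandermonde identity separates \<open>s\<close> from \<open>m\<close>, and up
  to a factor \<open>(x + q) ... (x + q ^ i)\<close> the resulting block coefficients are symmetric in the variables
  \<open>x\<close>, \<open>z\<close> marking peaks and rises (a relative of Fine's symmetry of the Rogers--Fine function).  The
  gauge factors cancel along the chain of blocks and are trivial at its start, so the whole generating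
  function is symmetric; comparing coefficients gives equally many paths on both sides with prescribed
  area and bounce.
\<close>

section \<open>Symmetry of the block coefficients\<close>

text \<open>Within a block, the excess of a row's area over the number of earlier rows of the block
  without decorated peak never increases, and a marked row repeats it; so the areas amount to weakly
  decreasing sequences, counted by q-binomials. A north step cannot carry both decorations, so each
  transition between consecutive rows is of one of three kinds and a q-trinomial appears. The
  obstacle is that peaks and rises act differently: \<open>r\<close> marked rows leave
  \<open>N - r\<close> rows for the area, whereas \<open>d\<close> decorated peaks change the count
  handed to the next block, through \<open>N - d\<close>. After expansion in
  \<open>qbin q (N - r) i\<close> and \<open>qbin q (N - d) j\<close>, exchanging \<open>x\<close>
  and \<open>z\<close> transposes \<open>i\<close> and \<open>j\<close>; what must be shown is that
  for fixed \<open>i\<close>, \<open>j\<close> the exchange costs only a gauge. The gauge originates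
  in the last row of a block, whose peak decoration is still free: the two choices combine
  neighbouring arguments of the next run, and Pascal's rule turns this into a factor
  \<open>x + q ^ Suc i\<close>. A single run is in general not symmetric, so the induction has to
  carry the gauge.\<close>

fun qbin :: "real \<Rightarrow> nat \<Rightarrow> nat \<Rightarrow> real" where
  "qbin q n 0 = 1"
| "qbin q 0 (Suc k) = 0"
| "qbin q (Suc n) (Suc k) = qbin q n k + q ^ Suc k * qbin q n (Suc k)"

lemma qbin_0_left: "qbin q 0 k = (if k = 0 then 1 else 0)"
  by (cases k) auto

lemma qbin_eq_0: "n < k \<Longrightarrow> qbin q n k = 0"
proof (induction n arbitrary: k)
  case 0 then show ?case by (cases k) auto
next
  case (Suc n) then show ?case by (cases k) auto
qed

text \<open>The factor \<open>q ^ k - q ^ n\<close> stands for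
  \<open>q ^ k * (1 - q ^ (n - k))\<close>; in this form there is no truncated subtraction, and the
  identity survives for \<open>n < k\<close>, where both binomials vanish.\<close>

lemma qbin_absorb:
  "q ^ k * (1 - q ^ Suc k) * qbin q n (Suc k) = (q ^ k - q ^ n) * qbin q n k"
proof (induction n arbitrary: k)
  case 0 then show ?case by (cases k) auto
next
  case (Suc n)
  show ?case
  proof (cases k)
    case 0
    have "(1 - q) * qbin q n (Suc 0) = 1 - q ^ n" using Suc[of 0] by simp
    then have "q * ((1 - q) * qbin q n (Suc 0)) = q * (1 - q ^ n)" by simp
    then show ?thesis using 0 by (simp add: algebra_simps)
  next
    case (Suc l)
    have h1: "q * (q ^ l * (1 - q ^ Suc l) * qbin q n (Suc l)) = q * ((q ^ l - q ^ n) * qbin q n l)"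
      by (simp only: Suc.IH[of l])
    have h2: "q^Suc (Suc l) * (q ^ Suc l * (1 - q ^ Suc (Suc l)) * qbin q n (Suc (Suc l)))
        = q^Suc (Suc l) * ((q ^ Suc l - q ^ n) * qbin q n (Suc l))"
      by (simp only: Suc.IH[of "Suc l"])
    show ?thesis using h1 h2 unfolding Suc qbin.simps
      by (simp add: algebra_simps)
  qed
qed

lemma qbin_absorb2:
  "(1 - q ^ Suc k) * qbin q (Suc n) (Suc k) = (1 - q ^ Suc n) * qbin q n k"
proof -
  have "q * (q ^ k * (1 - q ^ Suc k) * qbin q n (Suc k)) = q * ((q ^ k - q ^ n) * qbin q n k)"
    by (simp only: qbin_absorb)
  then show ?thesis by (simp add: algebra_simps)
qed

text \<open>The other Pascal rule, from the defining one by absorption after multiplying through by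
  \<open>q ^ k\<close>. It makes the hockey-stick sum telescope.\<close>

lemma qbin_diff:
  assumes "q \<noteq> 0" "k \<le> n"
  shows "qbin q (Suc n) (Suc k) = qbin q n (Suc k) + q ^ (n - k) * qbin q n k"
proof -
  have "q ^ k * q ^ (n - k) = q ^ n" using assms(2) by (simp flip: power_add)
  then have "q ^ n * qbin q n k = q ^ k * (q ^ (n - k) * qbin q n k)"
    by (metis mult.assoc)
  then have "q ^ k * qbin q (Suc n) (Suc k) = q ^ k * (qbin q n (Suc k) + q ^ (n - k) * qbin q n k)"
    using qbin_absorb[of q k n] unfolding qbin.simps by (simp only: algebra_simps power_Suc)
  then show ?thesis using assms(1) by simp
qed

lemma qbin_hockey_stick:
  assumes "q \<noteq> 0"
  shows "(\<Sum>e<s. q ^ e * qbin q (e + m) m) = qbin q (s + m) (Suc m)"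
proof (induction s)
  case 0 then show ?case by (simp add: qbin_eq_0)
next
  case (Suc s)
  then show ?case using qbin_diff[OF assms, of m "s + m"] by simp
qed

text \<open>Pascal's rule for \<open>qbin q m i\<close> splits the sum in two; the halves recombine
  by Pascal's rule in \<open>s\<close>, with \<open>s\<close> and \<open>c\<close> both raised by
  one, so the induction must generalise over them. The free bound \<open>M\<close> lets sums with
  different \<open>m\<close> share one range.\<close>

lemma qbin_vandermonde:
  "m \<le> M \<Longrightarrow> (\<Sum>i\<le>M. q ^ (i * (i + c)) * qbin q s (i + c) * qbin q m i) = qbin q (s + m) (m + c)"
proof (induction m arbitrary: M s c)
  case 0
  have "(\<Sum>i\<le>M. q ^ (i * (i + c)) * qbin q s (i + c) * qbin q 0 i) =
     (\<Sum>i\<le>M. if i = 0 then qbin q s c else 0)"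
    by (intro sum.cong) (auto simp: qbin_0_left)
  then show ?case by simp
next
  case (Suc m)
  then obtain M' where M: "M = Suc M'" "m \<le> M'" by (cases M) auto
  define f where "f i = q ^ (i * (i + Suc c)) * qbin q s (i + c) * qbin q m i" for i
  define g where "g i = q ^ (i * (i + Suc c)) * (q ^ Suc (i + c) * qbin q s (Suc (i + c))) * qbin q m i" for i
  have "(\<Sum>i\<le>M. q ^ (i * (i + c)) * qbin q s (i + c) * qbin q (Suc m) i)
     = f 0 + (\<Sum>i\<le>M'. q ^ (Suc i * (Suc i + c)) * qbin q s (Suc i + c) * qbin q (Suc m) (Suc i))"
    unfolding M(1) sum.atMost_Suc_shift by (simp add: f_def)
  also have "(\<Sum>i\<le>M'. q ^ (Suc i * (Suc i + c)) * qbin q s (Suc i + c) * qbin q (Suc m) (Suc i))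
      = (\<Sum>i\<le>M'. g i + f (Suc i))"
    by (intro sum.cong) (auto simp: f_def g_def algebra_simps power_add)
  also have "f 0 + \<dots> = (\<Sum>i\<le>M. f i) + (\<Sum>i\<le>M'. g i)"
    unfolding M(1) sum.atMost_Suc_shift by (simp add: sum.distrib)
  also have "(\<Sum>i\<le>M'. g i) = (\<Sum>i\<le>M. g i)"
    unfolding M(1) using M(2) by (simp add: g_def qbin_eq_0)
  also have "(\<Sum>i\<le>M. f i) + (\<Sum>i\<le>M. g i) = (\<Sum>i\<le>M. q ^ (i * (i + Suc c)) * qbin q (Suc s) (i + Suc c) * qbin q m i)"
    unfolding sum.distrib[symmetric] by (intro sum.cong) (auto simp: f_def g_def algebra_simps)
  also have "\<dots> = qbin q (Suc s + m) (m + Suc c)"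
    using Suc.prems by (intro Suc.IH) auto
  finally show ?case by simp
qed

section \<open>Weighted sums over q-trinomial coefficients\<close>

definition qfact :: "real \<Rightarrow> nat \<Rightarrow> real" where
  "qfact q n = (\<Prod>h=1..n. 1 - q ^ h)"

lemma qfact_Suc: "qfact q (Suc n) = (1 - q ^ Suc n) * qfact q n"
  by (simp add: qfact_def)

lemma qfact_nonzero: "0 < q \<Longrightarrow> q < 1 \<Longrightarrow> qfact q n \<noteq> 0"
proof (induction n)
  case (Suc n)
  then show ?case using power_Suc_less_one[of q n] by (simp add: qfact_Suc)
qed (simp add: qfact_def)

text \<open>The fraction is the q-trinomial coefficient for words with \<open>d\<close>,
  \<open>r\<close> and \<open>N - d - r\<close> letters. The letters are the transitions between
  consecutive rows of a block: decorated peak on the earlier row, decorated rise out of it, or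
  neither. The exponent of \<open>q\<close> is the triangular number of the neutral letters.\<close>

definition weight :: "real \<Rightarrow> real \<Rightarrow> real \<Rightarrow> nat \<Rightarrow> nat \<times> nat \<Rightarrow> real" where
  "weight q x z N = (\<lambda>(d, r). qfact q N / (qfact q d * qfact q r * qfact q (N - d - r))
     * q ^ (\<Sum>i\<le>N - d - r. i) * x ^ d * z ^ r)"

definition triangle :: "nat \<Rightarrow> (nat \<times> nat) set" where
  "triangle N = {(d, r). d + r \<le> N}"

definition wsum :: "real \<Rightarrow> real \<Rightarrow> real \<Rightarrow> nat \<Rightarrow> (nat \<Rightarrow> nat \<Rightarrow> real) \<Rightarrow> real" where
  "wsum q x z N f = (\<Sum>p\<in>triangle N. weight q x z N p * f (fst p) (snd p))"

lemma finite_triangle: "finite (triangle N)"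
  by (rule finite_subset[of _ "{..N} \<times> {..N}"]) (auto simp: triangle_def)

lemma wsum_cong:
  assumes "\<And>d r. d + r \<le> N \<Longrightarrow> f d r = g d r"
  shows "wsum q x z N f = wsum q x z N g"
  unfolding wsum_def by (intro sum.cong) (auto simp: triangle_def assms)

lemma wsum_add: "wsum q x z N (\<lambda>d r. f d r + g d r) = wsum q x z N f + wsum q x z N g"
  by (simp add: wsum_def sum.distrib algebra_simps)

lemma wsum_diff: "wsum q x z N (\<lambda>d r. f d r - g d r) = wsum q x z N f - wsum q x z N g"
  by (simp add: wsum_def sum_subtractf algebra_simps)

lemma wsum_scale: "wsum q x z N (\<lambda>d r. c * f d r) = c * wsum q x z N f"
  by (simp add: wsum_def sum_distrib_left algebra_simps)

lemma wsum_sum: "wsum q x z N (\<lambda>d r. \<Sum>i\<in>I. f i d r) = (\<Sum>i\<in>I. wsum q x z N (f i))"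
  unfolding wsum_def sum_distrib_left by (rule sum.swap)

lemma wsum_0: "0 < q \<Longrightarrow> q < 1 \<Longrightarrow> wsum q x z 0 f = f 0 0"
proof -
  have "triangle 0 = {(0,0)}" by (auto simp: triangle_def)
  then show ?thesis by (simp add: wsum_def weight_def qfact_def)
qed

lemma wsum_swap: "wsum q x z N f = wsum q z x N (\<lambda>d r. f r d)"
  unfolding wsum_def
  by (rule sum.reindex_bij_witness[of _ prod.swap prod.swap])
     (auto simp: triangle_def weight_def ac_simps diff_commute)

text \<open>The factor \<open>1 - q ^ d\<close> kills the terms with \<open>d = 0\<close> and
  otherwise cancels the top factor of \<open>qfact q d\<close>, so the rest reindexes over the
  smaller triangle.\<close>

lemma wsum_factor_d:
  assumes "0 < q" "q < 1"
  shows "wsum q x z (Suc N) (\<lambda>d r. (1 - q ^ d) * f d r)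
     = (1 - q ^ Suc N) * x * wsum q x z N (\<lambda>d r. f (Suc d) r)"
proof -
  let ?h = "\<lambda>p. weight q x z (Suc N) p * ((1 - q ^ fst p) * f (fst p) (snd p))"
  have "wsum q x z (Suc N) (\<lambda>d r. (1 - q ^ d) * f d r)
      = sum ?h ((\<lambda>(d, r). (Suc d, r)) ` triangle N)"
    unfolding wsum_def
  proof (rule sum.mono_neutral_right[OF finite_triangle])
    show "\<forall>i\<in>triangle (Suc N) - (\<lambda>(d, r). (Suc d, r)) ` triangle N. ?h i = 0"
    proof
      fix i assume i: "i \<in> triangle (Suc N) - (\<lambda>(d, r). (Suc d, r)) ` triangle N"
      have "fst i = 0"
      proof (rule ccontr)
        assume "fst i \<noteq> 0"
        then have "i = (\<lambda>(d, r). (Suc d, r)) (fst i - 1, snd i)" by (cases i) auto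
        moreover have "(fst i - 1, snd i) \<in> triangle N" using i \<open>fst i \<noteq> 0\<close> by (auto simp: triangle_def)
        ultimately show False using i by blast
      qed
      then show "?h i = 0" by simp
    qed
  qed (auto simp: triangle_def)
  also have "\<dots> = (\<Sum>p\<in>triangle N. ?h (Suc (fst p), snd p))"
    by (subst sum.reindex) (auto simp: inj_on_def case_prod_unfold)
  also have "\<dots> = (1 - q ^ Suc N) * x * wsum q x z N (\<lambda>d r. f (Suc d) r)"
  proof -
    have "?h (Suc (fst p), snd p) = (1 - q ^ Suc N) * x * (weight q x z N p * f (Suc (fst p)) (snd p))" for p
    proof -
      have "qfact q (Suc (fst p)) \<noteq> 0" using assms by (rule qfact_nonzero)
      then have nz: "1 - q ^ Suc (fst p) \<noteq> 0" unfolding qfact_Suc by auto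
      have "n * F / (c * A * B * C) * P * (x * X) * Z * (c * v) = n * x * (F / (A * B * C) * P * X * Z * v)"
        if "c \<noteq> 0" for n F c A B C P X Z v :: real
        using that by (simp add: field_simps)
      from this[OF nz] show ?thesis
        unfolding weight_def case_prod_unfold fst_conv snd_conv qfact_Suc power_Suc diff_Suc_Suc .
    qed
    then show ?thesis by (simp only: wsum_def sum_distrib_left fst_conv snd_conv)
  qed
  finally show ?thesis .
qed

lemma wsum_factor_r:
  assumes "0 < q" "q < 1"
  shows "wsum q x z (Suc N) (\<lambda>d r. (1 - q ^ r) * f d r)
     = (1 - q ^ Suc N) * z * wsum q x z N (\<lambda>d r. f d (Suc r))"
  using wsum_factor_d[OF assms, of z x N "\<lambda>d r. f r d"]
  by (simp add: wsum_swap[of q x z])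

text \<open>The same cancellation for neutral letters; the new power of \<open>q\<close> is the top
  summand of the triangular number.\<close>

lemma wsum_factor_k:
  assumes "0 < q" "q < 1"
  shows "wsum q x z (Suc N) (\<lambda>d r. (1 - q ^ (Suc N - d - r)) * f d r)
     = (1 - q ^ Suc N) * wsum q x z N (\<lambda>d r. q ^ Suc (N - d - r) * f d r)"
proof -
  let ?h = "\<lambda>p. weight q x z (Suc N) p * ((1 - q ^ (Suc N - fst p - snd p)) * f (fst p) (snd p))"
  have "wsum q x z (Suc N) (\<lambda>d r. (1 - q ^ (Suc N - d - r)) * f d r) = sum ?h (triangle N)"
    unfolding wsum_def
  proof (rule sum.mono_neutral_right[OF finite_triangle])
    show "\<forall>i\<in>triangle (Suc N) - triangle N. ?h i = 0"
      by (auto simp: triangle_def le_Suc_eq)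
  qed (auto simp: triangle_def)
  also have "\<dots> = (1 - q ^ Suc N) * wsum q x z N (\<lambda>d r. q ^ Suc (N - d - r) * f d r)"
  proof -
    have "?h p = (1 - q ^ Suc N) * (weight q x z N p * (q ^ Suc (N - fst p - snd p) * f (fst p) (snd p)))"
      if "p \<in> triangle N" for p
    proof -
      obtain d r where p: "p = (d, r)" by (cases p)
      have "d + r \<le> N" using that p by (auto simp: triangle_def)
      then have k: "Suc N - d - r = Suc (N - d - r)" by simp
      have "qfact q (Suc (N - d - r)) \<noteq> 0" using assms by (rule qfact_nonzero)
      then have nz: "1 - q ^ Suc (N - d - r) \<noteq> 0" unfolding qfact_Suc by auto
      have "n * F / (A * B * (c * C)) * (P * Q) * X * Z * (c * v) = n * (F / (A * B * C) * P * X * Z * (Q * v))"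
        if "c \<noteq> 0" for n F c A B C P Q X Z v :: real
        using that by (simp add: field_simps)
      from this[OF nz] show ?thesis
        unfolding p weight_def case_prod_unfold fst_conv snd_conv k qfact_Suc sum.atMost_Suc power_add .
    qed
    then show ?thesis unfolding wsum_def sum_distrib_left by (intro sum.cong) auto
  qed
  finally show ?thesis .
qed

text \<open>Pascal's rule for q-trinomials: with \<open>k = Suc N - d - r\<close>, write
  \<open>1 - q ^ Suc N\<close> as \<open>(1 - q ^ d) + q ^ d * (1 - q ^ k) + q ^ (d + k) * (1 - q ^
  r)\<close> and let one factor rule absorb each summand.\<close>

lemma wsum_Suc:
  assumes "0 < q" "q < 1"
  shows "wsum q x z (Suc N) f = x * wsum q x z N (\<lambda>d r. f (Suc d) r)
     + wsum q x z N (\<lambda>d r. q ^ (Suc N - r) * f d r)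
     + z * wsum q x z N (\<lambda>d r. q ^ (N - r) * f d (Suc r))"
proof -
  have "qfact q (Suc N) \<noteq> 0" using assms by (rule qfact_nonzero)
  then have nz: "1 - q ^ Suc N \<noteq> 0" unfolding qfact_Suc by auto
  have "(1 - q ^ Suc N) * wsum q x z (Suc N) f
     = wsum q x z (Suc N) (\<lambda>d r. (1 - q ^ d) * f d r
         + (1 - q ^ (Suc N - d - r)) * (q ^ d * f d r) + (1 - q ^ r) * (q ^ (Suc N - r) * f d r))"
    unfolding wsum_scale[symmetric]
  proof (rule wsum_cong)
    fix d r assume le: "d + r \<le> Suc N"
    have "q ^ (Suc N - d - r) * q ^ d = q ^ (Suc N - r)" using le by (simp flip: power_add)
    moreover have "q ^ r * q ^ (Suc N - r) = q ^ Suc N" using le by (simp flip: power_add power_Suc)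
    ultimately show "(1 - q ^ Suc N) * f d r = (1 - q ^ d) * f d r
         + (1 - q ^ (Suc N - d - r)) * (q ^ d * f d r) + (1 - q ^ r) * (q ^ (Suc N - r) * f d r)"
      by (simp add: algebra_simps del: power_Suc)
  qed
  also have "\<dots> = (1 - q ^ Suc N) * (x * wsum q x z N (\<lambda>d r. f (Suc d) r)
     + wsum q x z N (\<lambda>d r. q ^ Suc (N - d - r) * (q ^ d * f d r))
     + z * wsum q x z N (\<lambda>d r. q ^ (N - r) * f d (Suc r)))"
    unfolding wsum_add wsum_factor_d[OF assms] wsum_factor_r[OF assms] wsum_factor_k[OF assms]
    by (simp add: algebra_simps)
  also have "wsum q x z N (\<lambda>d r. q ^ Suc (N - d - r) * (q ^ d * f d r)) =
      wsum q x z N (\<lambda>d r. q ^ (Suc N - r) * f d r)"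
    by (rule wsum_cong) (auto simp flip: power_add power_Suc mult.assoc simp: Suc_diff_le)
  finally show ?thesis using nz by simp
qed

text \<open>
  The recursion in \<open>j\<close> below has coefficients symmetric in \<open>x\<close> and \<open>z\<close>, apart from the
  factor \<open>x + q ^ Suc j\<close>, which \<open>prodP\<close> absorbs.
\<close>

definition ymom :: "real \<Rightarrow> real \<Rightarrow> real \<Rightarrow> nat \<Rightarrow> nat \<Rightarrow> nat \<Rightarrow> real" where
  "ymom q x z N i j = wsum q x z N (\<lambda>d r. qbin q (N - r) i * qbin q (N - d) j)"

definition prodP :: "real \<Rightarrow> real \<Rightarrow> nat \<Rightarrow> real" where
  "prodP q x j = (\<Prod>h=1..j. x + q ^ h)"

lemma prodP_0 [simp]: "prodP q x 0 = 1" by (simp add: prodP_def)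
lemma prodP_Suc: "prodP q x (Suc j) = (x + q ^ Suc j) * prodP q x j" by (simp add: prodP_def)

lemma prodP_pos: "0 < q \<Longrightarrow> 0 < x \<Longrightarrow> 0 < prodP q x j"
  unfolding prodP_def by (intro prod_pos) (simp add: add_pos_pos)

lemma ymom_swap: "ymom q x z N i j = ymom q z x N j i"
  unfolding ymom_def by (subst wsum_swap) (simp add: mult.commute)

text \<open>Absorption lowers \<open>qbin q (N - d) (Suc j)\<close> at the price of \<open>1 - q ^
  (N - d) = (1 - q ^ r) + q ^ r * (1 - q ^ (N - d - r))\<close>. The first part passes to size
  \<open>N - 1\<close> by \<open>wsum_factor_r\<close>. The second goes down by
  \<open>wsum_factor_k\<close> and up again by \<open>wsum_factor_d\<close>, trading a neutral
  letter for a peak; a second absorption then reproduces the left-hand moment with coefficient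
  \<open>- q ^ Suc j\<close>, whence the factor \<open>x + q ^ Suc j\<close>.\<close>

lemma ymom_Suc:
  assumes q: "0 < q" "q < 1"
  shows "(1 - q ^ Suc j) * (x + q ^ Suc j) * ymom q x z N i (Suc j) =
    (q ^ Suc j - q ^ Suc N) * ymom q x z N i j
    + x * z * (1 - q ^ N) * ymom q x z (N - 1) i j"
proof (cases N)
  case 0
  then show ?thesis by (simp add: ymom_def wsum_0[OF q] algebra_simps qbin_0_left)
next
  case (Suc M)
  let ?b = "\<lambda>d. qbin q (M - d) j"
  let ?g = "\<lambda>r. qbin q (N - r) i"
  let ?W = "wsum q x z N"
  \<comment> \<open>For \<open>d = N\<close> the argument \<open>M - d\<close> is truncated, but
    then both sides are zero.\<close>
  have absorb: "(1 - q ^ Suc j) * qbin q (N - d) (Suc j) = (1 - q ^ (N - d)) * ?b d" if "d \<le> N" for d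
  proof (cases "d = N")
    case False
    then have "N - d = Suc (M - d)" using that Suc by auto
    then show ?thesis using qbin_absorb2[of q j "M - d"] by simp
  qed simp
  have A: "(1 - q ^ Suc j) * ymom q x z N i (Suc j) = ?W (\<lambda>d r. (1 - q ^ (N - d)) * (?g r * ?b d))"
    unfolding ymom_def wsum_scale[symmetric]
    by (rule wsum_cong) (metis absorb add_leD1 mult.left_commute)
  have B: "z * (1 - q ^ N) * ymom q x z M i j = ?W (\<lambda>d r. (1 - q ^ r) * (?g r * ?b d))"
    unfolding Suc wsum_factor_r[OF q] ymom_def by (simp add: algebra_simps)
  have "x * ((1 - q ^ Suc j) * ymom q x z N i (Suc j)) - x * (z * (1 - q ^ N) * ymom q x z M i j)
    = x * ?W (\<lambda>d r. (1 - q ^ (N - d - r)) * (q ^ r * (?g r * ?b d)))"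
    unfolding A B wsum_scale[symmetric] wsum_diff[symmetric]
  proof (rule wsum_cong)
    fix d r assume "d + r \<le> N"
    then have "q ^ (N - d) = q ^ (N - d - r) * q ^ r" by (simp flip: power_add)
    then show "x * ((1 - q ^ (N - d)) * (?g r * ?b d)) - x * ((1 - q ^ r) * (?g r * ?b d))
       = x * ((1 - q ^ (N - d - r)) * (q ^ r * (?g r * ?b d)))"
      by (simp add: algebra_simps)
  qed
  also have "\<dots> = (1 - q ^ N) * x * wsum q x z M (\<lambda>d r. q ^ Suc (M - d - r) * (q ^ r * (?g r * ?b d)))"
    unfolding Suc wsum_factor_k[OF q] by simp
  also have "wsum q x z M (\<lambda>d r. q ^ Suc (M - d - r) * (q ^ r * (?g r * ?b d)))
     = wsum q x z M (\<lambda>d r. q ^ (Suc N - Suc d) * (?g r * qbin q (N - Suc d) j))"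
    unfolding Suc by (rule wsum_cong) (auto simp flip: power_add power_Suc mult.assoc simp: Suc_diff_le)
  also have "(1 - q ^ N) * x * \<dots> = ?W (\<lambda>d r. (1 - q ^ d) * (q ^ (Suc N - d) * (?g r * qbin q (N - d) j)))"
    unfolding Suc wsum_factor_d[OF q] by simp
  also have "\<dots> = ?W (\<lambda>d r. (q ^ Suc j - q ^ Suc N) * (?g r * qbin q (N - d) j)
        - q ^ Suc j * ((1 - q ^ Suc j) * (?g r * qbin q (N - d) (Suc j))))"
  proof (rule wsum_cong)
    fix d r assume "d + r \<le> N"
    then have "Suc N - d = Suc (N - d)" and "q ^ d * q ^ (N - d) = q ^ N" by (auto simp flip: power_add)
    then have "(1 - q ^ d) * (q ^ (Suc N - d) * (?g r * qbin q (N - d) j)) =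
       (q * q ^ (N - d) - q * q ^ N) * (?g r * qbin q (N - d) j)" by (simp add: algebra_simps)
    moreover have "q * ?g r * (q ^ j * (1 - q ^ Suc j) * qbin q (N - d) (Suc j)) = q * ?g r * ((q ^ j - q ^ (N - d)) * qbin q (N - d) j)"
      by (simp only: qbin_absorb)
    ultimately show "(1 - q ^ d) * (q ^ (Suc N - d) * (?g r * qbin q (N - d) j)) =
       (q ^ Suc j - q ^ Suc N) * (?g r * qbin q (N - d) j)
        - q ^ Suc j * ((1 - q ^ Suc j) * (?g r * qbin q (N - d) (Suc j)))"
      by (simp add: algebra_simps)
  qed
  also have "\<dots> = (q ^ Suc j - q ^ Suc N) * ymom q x z N i j - q ^ Suc j * ((1 - q ^ Suc j) * ymom q x z N i (Suc j))"
    unfolding wsum_diff wsum_scale ymom_def ..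
  finally show ?thesis using Suc by (simp add: algebra_simps)
qed

text \<open>The gauged recursion in \<open>j\<close> has symmetric coefficients, so only
  \<open>j = 0\<close> remains. By \<open>ymom_swap\<close> this is the case of first index
  \<open>0\<close> with \<open>x\<close> and \<open>z\<close> exchanged, and the same recursion
  reduces it to \<open>i = j = 0\<close>, where transposition is trivial.\<close>

lemma ymom_symmetric:
  assumes q: "0 < q" "q < 1"
  shows "ymom q x z N i j * prodP q x j * prodP q z i = ymom q z x N i j * prodP q z j * prodP q x i"
proof -
  have step: "(1 - q ^ Suc j) * (ymom q u v N i (Suc j) * prodP q u (Suc j) * prodP q v i) =
      (q ^ Suc j - q ^ Suc N) * (ymom q u v N i j * prodP q u j * prodP q v i)
      + u * v * (1 - q ^ N) * (ymom q u v (N - 1) i j * prodP q u j * prodP q v i)" for u v N i j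
  proof -
    have "(1 - q ^ Suc j) * (ymom q u v N i (Suc j) * prodP q u (Suc j) * prodP q v i) =
      ((1 - q ^ Suc j) * (u + q ^ Suc j) * ymom q u v N i (Suc j)) * (prodP q u j * prodP q v i)"
      unfolding prodP_Suc by (simp only: ac_simps)
    then show ?thesis unfolding ymom_Suc[OF q] by (simp add: algebra_simps)
  qed
  have nz: "1 - q ^ Suc j \<noteq> 0" for j
    using qfact_nonzero[OF q, of "Suc j"] unfolding qfact_Suc by auto
  have gen: "ymom q x z N i j * prodP q x j * prodP q z i = ymom q z x N i j * prodP q z j * prodP q x i"
    if base: "\<And>N. ymom q x z N i 0 * prodP q z i = ymom q z x N i 0 * prodP q x i" for x z N i j
  proof (induction j arbitrary: N)
    case 0
    then show ?case using base by simp
  next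
    case (Suc j)
    have "(1 - q ^ Suc j) * (ymom q x z N i (Suc j) * prodP q x (Suc j) * prodP q z i) =
      (1 - q ^ Suc j) * (ymom q z x N i (Suc j) * prodP q z (Suc j) * prodP q x i)"
      unfolding step Suc.IH by (simp add: ac_simps)
    then show ?case using nz[of j] by simp
  qed
  have z00: "ymom q x z N 0 0 = ymom q z x N 0 0" for N
    by (rule ymom_swap)
  have zi: "ymom q x z N i 0 * prodP q z i = ymom q z x N i 0 * prodP q x i" for N
    using gen[of z x 0 N i] z00 ymom_swap[of q x z N i 0] ymom_swap[of q z x N i 0] by simp
  show ?thesis using gen zi by blast
qed

section \<open>The transfer recursion\<close>

text \<open>
  \<open>tail_gf q t x z r H s pv\<close> generates the possible last \<open>r\<close> rows: the next row has area at most \<open>H\<close>,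
  the current block has \<open>s\<close> rows without decorated peak, and \<open>pv\<close> says whether the previous row is
  such a row.  A row of area \<open>w < s\<close> opens a new block, which raises the bounce label of all
  remaining rows by one.
\<close>

primrec tail_gf :: "real \<Rightarrow> real \<Rightarrow> real \<Rightarrow> real \<Rightarrow> nat \<Rightarrow> nat \<Rightarrow> nat \<Rightarrow> bool \<Rightarrow> real" where
  "tail_gf q t x z 0 = (\<lambda>H s pv. if pv then 1 else 0)"
| "tail_gf q t x z (Suc r) = (\<lambda>H s pv. \<Sum>w\<le>H. (q ^ w + (if pv \<and> w = H then z else 0)) *
     (if w < s then t ^ Suc r * (tail_gf q t x z r (Suc w) 1 True + x * tail_gf q t x z r w 0 False)
      else tail_gf q t x z r (Suc w) (Suc s) True + x * tail_gf q t x z r w s False))"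

text \<open>The current row has area \<open>s + e\<close>, with \<open>s\<close> counted before it;
  the two terms are its possible peak decorations. The excess \<open>e\<close> is the right
  parameter because the bound on the next area and the count \<open>s\<close> grow together.\<close>

definition row_gf :: "real \<Rightarrow> real \<Rightarrow> real \<Rightarrow> real \<Rightarrow> nat \<Rightarrow> nat \<Rightarrow> nat \<Rightarrow> real" where
  "row_gf q t x z r e s =
     tail_gf q t x z r (Suc (s + e)) (Suc s) True + x * tail_gf q t x z r (s + e) s False"

text \<open>All continuations after a block with count \<open>s\<close> is broken by a row of area
  \<open>e < s\<close>, followed by \<open>r\<close> more rows. The factor \<open>t ^ Suc r\<close>
  for the raised labels is supplied where runs are used.\<close>

definition run_gf :: "real \<Rightarrow> real \<Rightarrow> real \<Rightarrow> real \<Rightarrow> nat \<Rightarrow> nat \<Rightarrow> real" where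
  "run_gf q t x z r s = (\<Sum>e<s. q ^ e * row_gf q t x z r e 0)"

lemma tail_gf_Suc:
  "tail_gf q t x z (Suc r) (s + e) s pv = t ^ Suc r * run_gf q t x z r s
     + q ^ s * (\<Sum>e'\<le>e. q ^ e' * row_gf q t x z r e' s)
     + (if pv then z * row_gf q t x z r e s else 0)"
proof -
  define G where "G w = (if w < s then t ^ Suc r * row_gf q t x z r w 0
      else row_gf q t x z r (w - s) s)" for w
  have "tail_gf q t x z (Suc r) (s + e) s pv
      = (\<Sum>w\<le>s + e. (q ^ w + (if pv \<and> w = s + e then z else 0)) * G w)"
    unfolding tail_gf.simps by (intro sum.cong) (auto simp: G_def row_gf_def)
  also have "\<dots> = (\<Sum>w\<le>s + e. q ^ w * G w) + (\<Sum>w\<le>s + e. if w = s + e then (if pv then z * G (s + e) else 0) else 0)"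
    unfolding sum.distrib[symmetric] by (intro sum.cong) (auto simp: algebra_simps)
  also have "(\<Sum>w\<le>s + e. if w = s + e then (if pv then z * G (s + e) else 0) else 0)
      = (if pv then z * row_gf q t x z r e s else 0)"
    by (simp add: G_def)
  also have "(\<Sum>w\<le>s + e. q ^ w * G w) = (\<Sum>w<s. q ^ w * G w) + (\<Sum>w=s..s + e. q ^ w * G w)"
    by (subst sum.union_disjoint[symmetric]) (auto intro: sum.cong)
  also have "(\<Sum>w<s. q ^ w * G w) = t ^ Suc r * run_gf q t x z r s"
    unfolding run_gf_def sum_distrib_left by (intro sum.cong) (auto simp: G_def)
  also have "(\<Sum>w=s..s + e. q ^ w * G w) = q ^ s * (\<Sum>e'\<le>e. q ^ e' * row_gf q t x z r e' s)"
    unfolding sum_distrib_left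
    by (rule sum.reindex_bij_witness[of _ "\<lambda>w. s + w" "\<lambda>w. w - s"])
       (auto simp: G_def simp flip: power_add mult.assoc)
  finally show ?thesis .
qed

lemma row_gf_Suc:
  "row_gf q t x z (Suc r) e s = t ^ Suc r * (run_gf q t x z r (Suc s) + x * run_gf q t x z r s)
     + q ^ Suc s * (\<Sum>e'\<le>e. q ^ e' * row_gf q t x z r e' (Suc s))
     + z * row_gf q t x z r e (Suc s)
     + x * q ^ s * (\<Sum>e'\<le>e. q ^ e' * row_gf q t x z r e' s)"
  unfolding row_gf_def[of q t x z "Suc r"]
  using tail_gf_Suc[of q t x z r "Suc s" e True] tail_gf_Suc[of q t x z r s e False]
  by (simp add: algebra_simps)

text \<open>Continuation after the last row of a block, where \<open>s\<close> is the count before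
  that row and its peak decoration is still open. With no rows left only the undecorated choice is
  admissible, hence the value \<open>1\<close>.\<close>

definition next_gf :: "real \<Rightarrow> real \<Rightarrow> real \<Rightarrow> real \<Rightarrow> nat \<Rightarrow> nat \<Rightarrow> real" where
  "next_gf q t x z r s = (case r of 0 \<Rightarrow> 1
     | Suc k \<Rightarrow> t ^ r * (run_gf q t x z k (Suc s) + x * run_gf q t x z k s))"

text \<open>Closed form for a row followed by \<open>N\<close> more rows of the same block. The
  \<open>N - r\<close> unmarked ones have weakly decreasing excesses bounded by \<open>e\<close>,
  counted by the q-binomial; marked ones repeat an excess and cost no area. The count before the
  last row is \<open>s + (N - d)\<close>, and its growth on the way is paid for by the powers of
  \<open>q\<close> inside the weight.\<close>

definition block_gf :: "real \<Rightarrow> real \<Rightarrow> real \<Rightarrow> nat \<Rightarrow> (nat \<Rightarrow> real) \<Rightarrow> nat \<Rightarrow> nat \<Rightarrow> real" where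
  "block_gf q x z N \<phi> e s =
     wsum q x z N (\<lambda>d r. q ^ ((N - r) * s) * qbin q (e + (N - r)) (N - r) * \<phi> (s + (N - d)))"

lemma block_gf_0: "0 < q \<Longrightarrow> q < 1 \<Longrightarrow> block_gf q x z 0 \<phi> e s = \<phi> s"
  by (simp add: block_gf_def wsum_0)

lemma sum_block_gf:
  assumes "q \<noteq> 0"
  shows "(\<Sum>e<k. q ^ e * block_gf q x z N \<phi> e s) =
     wsum q x z N (\<lambda>d r. q ^ ((N - r) * s) * qbin q (k + (N - r)) (Suc (N - r)) * \<phi> (s + (N - d)))"
  unfolding block_gf_def wsum_scale[symmetric] wsum_sum[symmetric] qbin_hockey_stick[OF assms, symmetric]
  by (rule wsum_cong) (simp add: sum_distrib_left sum_distrib_right ac_simps)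

text \<open>The terms condition on the first transition (neutral, rise, peak) and match those of
  \<open>wsum_Suc\<close>; where the next row is unmarked, the sum over its excess is a hockey-stick
  sum.\<close>

lemma block_gf_Suc:
  assumes q: "0 < q" "q < 1"
  shows "block_gf q x z (Suc N) \<phi> e s =
     q ^ Suc s * (\<Sum>e'\<le>e. q ^ e' * block_gf q x z N \<phi> e' (Suc s))
     + z * block_gf q x z N \<phi> e (Suc s)
     + x * q ^ s * (\<Sum>e'\<le>e. q ^ e' * block_gf q x z N \<phi> e' s)"
proof -
  have q0: "q \<noteq> 0" using q by simp
  have 1: "wsum q x z N (\<lambda>d r. q ^ ((Suc N - r) * s) * qbin q (e + (Suc N - r)) (Suc N - r) * \<phi> (s + (Suc N - Suc d)))
     = q ^ s * (\<Sum>e'<Suc e. q ^ e' * block_gf q x z N \<phi> e' s)"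
    unfolding sum_block_gf[OF q0] wsum_scale[symmetric]
    by (rule wsum_cong) (auto simp: Suc_diff_le power_add simp del: qbin.simps)
  have 2: "wsum q x z N (\<lambda>d r. q ^ (Suc N - r) * (q ^ ((Suc N - r) * s) * qbin q (e + (Suc N - r)) (Suc N - r) * \<phi> (s + (Suc N - d))))
     = q ^ Suc s * (\<Sum>e'<Suc e. q ^ e' * block_gf q x z N \<phi> e' (Suc s))"
    unfolding sum_block_gf[OF q0] wsum_scale[symmetric]
  proof (rule wsum_cong)
    fix d r assume "d + r \<le> N"
    then have e: "Suc N - r = Suc (N - r)" "Suc N - d = Suc (N - d)" by auto
    have "q ^ Suc m * (q ^ (Suc m * s) * A * B) = q ^ Suc s * (q ^ (m * Suc s) * A * B)" for m A B
      by (simp add: power_add)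
    then show "q ^ (Suc N - r) * (q ^ ((Suc N - r) * s) * qbin q (e + (Suc N - r)) (Suc N - r) * \<phi> (s + (Suc N - d)))
      = q ^ Suc s * (q ^ ((N - r) * Suc s) * qbin q (Suc e + (N - r)) (Suc (N - r)) * \<phi> (Suc s + (N - d)))"
      unfolding e add_Suc_right add_Suc by simp
  qed
  have 3: "wsum q x z N (\<lambda>d r. q ^ (N - r) * (q ^ ((Suc N - Suc r) * s) * qbin q (e + (Suc N - Suc r)) (Suc N - Suc r) * \<phi> (s + (Suc N - d))))
     = block_gf q x z N \<phi> e (Suc s)"
    unfolding block_gf_def
  proof (rule wsum_cong)
    fix d r assume "d + r \<le> N"
    then have "Suc N - d = Suc (N - d)" by auto
    moreover have "q ^ m * (q ^ (m * s) * A * B) = q ^ (m * Suc s) * A * B" for m A B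
      by (simp add: power_add)
    ultimately show "q ^ (N - r) * (q ^ ((Suc N - Suc r) * s) * qbin q (e + (Suc N - Suc r)) (Suc N - Suc r) * \<phi> (s + (Suc N - d)))
      = q ^ ((N - r) * Suc s) * qbin q (e + (N - r)) (N - r) * \<phi> (Suc s + (N - d))"
      by simp
  qed
  show ?thesis
    unfolding block_gf_def[of q x z "Suc N"] wsum_Suc[OF q] 1 2 3 lessThan_Suc_atMost by simp
qed

text \<open>The recursion of \<open>row_gf\<close> is that of \<open>block_gf_Suc\<close> plus a
  term in which the next row opens a block; that term becomes the summand
  \<open>N = 0\<close>.\<close>

lemma row_gf_blocks:
  assumes q: "0 < q" "q < 1"
  shows "row_gf q t x z r e s = (\<Sum>N\<le>r. block_gf q x z N (next_gf q t x z (r - N)) e s)"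
proof (induction r arbitrary: e s)
  case 0
  show ?case by (simp add: block_gf_0[OF q] next_gf_def row_gf_def)
next
  case (Suc r)
  have sw: "(\<Sum>e'\<le>e. q ^ e' * (\<Sum>N\<le>r. f N e')) = (\<Sum>N\<le>r. \<Sum>e'\<le>e. q ^ e' * f N e')" for f :: "nat \<Rightarrow> nat \<Rightarrow> real"
    unfolding sum_distrib_left by (rule sum.swap)
  show ?case
    unfolding row_gf_Suc Suc.IH sum.atMost_Suc_shift[of _ r] block_gf_0[OF q] sw block_gf_Suc[OF q]
    by (simp add: sum.distrib sum_distrib_left next_gf_def)
qed

lemma run_gf_blocks:
  assumes q: "0 < q" "q < 1"
  shows "run_gf q t x z r s = (\<Sum>N\<le>r. wsum q x z N
     (\<lambda>d r'. qbin q (s + (N - r')) (Suc (N - r')) * next_gf q t x z (r - N) (N - d)))"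
proof -
  have "run_gf q t x z r s = (\<Sum>N\<le>r. \<Sum>e<s. q ^ e * block_gf q x z N (next_gf q t x z (r - N)) e 0)"
    unfolding run_gf_def row_gf_blocks[OF q] sum_distrib_left by (rule sum.swap)
  then show ?thesis using q by (simp add: sum_block_gf)
qed

text \<open>The hockey-stick sum over \<open>e < s\<close> raises the lower index by one, so
  Vandermonde is used with shift \<open>c = 1\<close>. Afterwards \<open>s\<close> enters only
  through the functions \<open>qbin q s (Suc i)\<close>, whose coefficients can be compared for the
  two orders of the variables.\<close>

lemma run_gf_expansion:
  assumes q: "0 < q" "q < 1"
  shows "run_gf q t x z r s = (\<Sum>i\<le>r. qbin q s (Suc i) * (q ^ (i * Suc i) *
     (\<Sum>N\<le>r. wsum q x z N (\<lambda>d r'. qbin q (N - r') i * next_gf q t x z (r - N) (N - d)))))"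
proof -
  have "wsum q x z N (\<lambda>d r'. qbin q (s + (N - r')) (Suc (N - r')) * next_gf q t x z (r - N) (N - d))
    = (\<Sum>i\<le>r. qbin q s (Suc i) * (q ^ (i * Suc i) *
        wsum q x z N (\<lambda>d r'. qbin q (N - r') i * next_gf q t x z (r - N) (N - d))))" if "N \<le> r" for N
    unfolding wsum_scale[symmetric] wsum_sum[symmetric]
  proof (rule wsum_cong)
    fix d r' assume "d + r' \<le> N"
    then have "qbin q (s + (N - r')) (Suc (N - r')) =
       (\<Sum>i\<le>r. q ^ (i * (i + 1)) * qbin q s (i + 1) * qbin q (N - r') i)"
      using that by (subst qbin_vandermonde) auto
    then show "qbin q (s + (N - r')) (Suc (N - r')) * next_gf q t x z (r - N) (N - d) =
      (\<Sum>i\<le>r. qbin q s (Suc i) * (q ^ (i * Suc i) * (qbin q (N - r') i * next_gf q t x z (r - N) (N - d))))"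
      by (simp add: sum_distrib_right sum_distrib_left ac_simps)
  qed
  then have "run_gf q t x z r s = (\<Sum>N\<le>r. \<Sum>i\<le>r. qbin q s (Suc i) * (q ^ (i * Suc i) *
        wsum q x z N (\<lambda>d r'. qbin q (N - r') i * next_gf q t x z (r - N) (N - d))))"
    unfolding run_gf_blocks[OF q] by (intro sum.cong) auto
  also have "\<dots> = (\<Sum>i\<le>r. \<Sum>N\<le>r. qbin q s (Suc i) * (q ^ (i * Suc i) *
        wsum q x z N (\<lambda>d r'. qbin q (N - r') i * next_gf q t x z (r - N) (N - d))))"
    by (rule sum.swap)
  finally show ?thesis by (simp add: sum_distrib_left)
qed

text \<open>The content is that one \<open>g\<close>, independent of \<open>s\<close>, serves both
  orders of the variables. Positivity of \<open>x\<close> and \<open>z\<close> makes the gauge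
  factors invertible.\<close>

lemma run_gf_symmetric_expansion:
  assumes q: "0 < q" "q < 1" and xz: "0 < x" "0 < z"
  shows "\<exists>g. \<forall>s. run_gf q t x z r s = (\<Sum>i\<le>r. qbin q s (Suc i) * (prodP q x i * g i)) \<and>
             run_gf q t z x r s = (\<Sum>i\<le>r. qbin q s (Suc i) * (prodP q z i * g i))"
proof (induction r rule: less_induct)
  case (less r)
  then have "\<forall>k. \<exists>g. k < r \<longrightarrow> (\<forall>s. run_gf q t x z k s = (\<Sum>i\<le>k. qbin q s (Suc i) * (prodP q x i * g i)) \<and>
             run_gf q t z x k s = (\<Sum>i\<le>k. qbin q s (Suc i) * (prodP q z i * g i)))"
    by auto
  from choice[OF this] obtain g where g: "\<And>k s. k < r \<Longrightarrow>
      run_gf q t x z k s = (\<Sum>i\<le>k. qbin q s (Suc i) * (prodP q x i * g k i))"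
      "\<And>k s. k < r \<Longrightarrow>
      run_gf q t z x k s = (\<Sum>i\<le>k. qbin q s (Suc i) * (prodP q z i * g k i))"
    by blast
  \<comment> \<open>By Pascal, \<open>qbin q (Suc s) (Suc i) + u * qbin q s (Suc i)\<close> equals
    \<open>qbin q s i + (u + q ^ Suc i) * qbin q s (Suc i)\<close>, and the bracket is the ratio of
    consecutive values of \<open>prodP\<close>.\<close>
  have nxt: "next_gf q t u v (Suc k) s = (\<Sum>j\<le>k. t ^ Suc k * g k j * (prodP q u j * qbin q s j + prodP q u (Suc j) * qbin q s (Suc j)))"
    if "\<And>s. run_gf q t u v k s = (\<Sum>i\<le>k. qbin q s (Suc i) * (prodP q u i * g k i))" for u v k s
    unfolding next_gf_def nat.case that sum_distrib_left sum.distrib[symmetric] prodP_Suc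
    by (intro sum.cong refl) (simp add: algebra_simps del: power_Suc)
  define F where "F u v i N = wsum q u v N (\<lambda>d r'. qbin q (N - r') i * next_gf q t u v (r - N) (N - d))" for u v i N
  define Y where "Y u v N i j = ymom q u v N i j * prodP q u j * prodP q v i" for u v N i j
  have Y: "Y x z N i j = Y z x N i j" for N i j
    unfolding Y_def by (rule ymom_symmetric[OF q])
  have F1: "prodP q v i * F u v i N = (\<Sum>j\<le>k. t ^ Suc k * g k j * (Y u v N i j + Y u v N i (Suc j)))"
    if k: "r - N = Suc k" and gu: "\<And>s. run_gf q t u v k s = (\<Sum>i\<le>k. qbin q s (Suc i) * (prodP q u i * g k i))"
    for u v i N k
  proof -
    have "F u v i N = wsum q u v N (\<lambda>d r'. \<Sum>j\<le>k. t ^ Suc k * g k j *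
      (prodP q u j * (qbin q (N - r') i * qbin q (N - d) j) + prodP q u (Suc j) * (qbin q (N - r') i * qbin q (N - d) (Suc j))))"
      unfolding F_def k nxt[OF gu] sum_distrib_left
      by (intro wsum_cong sum.cong refl) (simp only: distrib_left distrib_right ac_simps)
    also have "\<dots> = (\<Sum>j\<le>k. t ^ Suc k * g k j * (prodP q u j * ymom q u v N i j + prodP q u (Suc j) * ymom q u v N i (Suc j)))"
      unfolding wsum_sum wsum_scale wsum_add ymom_def ..
    finally show ?thesis
      by (simp only: Y_def sum_distrib_left distrib_left distrib_right ac_simps)
  qed
  have F2: "prodP q v i * F u v i r = Y u v r i 0" for u v i
    by (simp add: F_def Y_def ymom_def next_gf_def)
  have F: "prodP q z i * F x z i N = prodP q x i * F z x i N" if N: "N \<le> r" for i N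
  proof (cases "N = r")
    case True then show ?thesis using Y by (simp add: F2)
  next
    case False
    then obtain k where k: "r - N = Suc k" using N by (cases "r - N") auto
    then have "k < r" by simp
    show ?thesis unfolding F1[OF k g(1)[OF \<open>k < r\<close>]] F1[OF k g(2)[OF \<open>k < r\<close>]] Y ..
  qed
  \<comment> \<open>The value is chosen to fit the expansion for the order \<open>x\<close>,
    \<open>z\<close>; the symmetry \<open>S\<close> makes it fit the other one.\<close>
  define h where "h i = q ^ (i * Suc i) * (\<Sum>N\<le>r. F x z i N) / prodP q x i" for i
  have P: "prodP q x i > 0" "prodP q z i > 0" for i using prodP_pos q xz by auto
  have S: "prodP q z i * (\<Sum>N\<le>r. F x z i N) = prodP q x i * (\<Sum>N\<le>r. F z x i N)" for i
    unfolding sum_distrib_left by (intro sum.cong) (auto simp: F)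
  have hx: "prodP q x i * h i = q ^ (i * Suc i) * (\<Sum>N\<le>r. F x z i N)" for i
    using P(1)[of i] by (simp add: h_def)
  have hz: "prodP q z i * h i = q ^ (i * Suc i) * (\<Sum>N\<le>r. F z x i N)" for i
  proof -
    have "prodP q z i * h i = q ^ (i * Suc i) * (prodP q z i * (\<Sum>N\<le>r. F x z i N)) / prodP q x i"
      by (simp add: h_def)
    then show ?thesis unfolding S using P(1)[of i] by simp
  qed
  show ?case
  proof (intro exI[of _ h] allI conjI)
    show "run_gf q t x z r s = (\<Sum>i\<le>r. qbin q s (Suc i) * (prodP q x i * h i))" for s
      unfolding hx F_def by (rule run_gf_expansion[OF q])
    show "run_gf q t z x r s = (\<Sum>i\<le>r. qbin q s (Suc i) * (prodP q z i * h i))" for s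
      unfolding hz F_def by (rule run_gf_expansion[OF q])
  qed
qed

lemma qbin_1: "qbin q 1 (Suc i) = (if i = 0 then 1 else 0)"
  by (cases i) auto

text \<open>The first row has area \<open>0\<close> and breaks no block, so the whole function is a
  run with \<open>s = 1\<close>. There only \<open>i = 0\<close> survives, and its gauge factor is
  \<open>1\<close>.\<close>

lemma tail_gf_symmetric:
  assumes q: "0 < q" "q < 1" and xz: "0 < x" "0 < z"
  shows "tail_gf q t x z n 0 0 False = tail_gf q t z x n 0 0 False"
proof (cases n)
  case (Suc r)
  have *: "tail_gf q t u v n 0 0 False = run_gf q t u v r 1" for u v
    using tail_gf_Suc[of q t u v r 0 0 False] Suc by (simp add: run_gf_def)
  obtain g where "\<And>s. run_gf q t x z r s = (\<Sum>i\<le>r. qbin q s (Suc i) * (prodP q x i * g i))"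
             "\<And>s. run_gf q t z x r s = (\<Sum>i\<le>r. qbin q s (Suc i) * (prodP q z i * g i))"
    using run_gf_symmetric_expansion[OF q xz] by metis
  moreover have "(\<Sum>i\<le>r. qbin q 1 (Suc i) * (prodP q u i * g i)) = g 0" for u
  proof -
    have "(\<Sum>i\<le>r. qbin q 1 (Suc i) * (prodP q u i * g i)) = (\<Sum>i\<le>r. if i = 0 then g 0 else 0)"
      by (intro sum.cong) (auto simp: qbin_1 simp del: One_nat_def)
    then show ?thesis by simp
  qed
  ultimately show ?thesis by (simp add: * del: One_nat_def)
qed simp

section \<open>Row lists\<close>

text \<open>
  A row \<open>(w, st, mk)\<close> has area \<open>w\<close>; \<open>st\<close> says that its north step is a decorated peak, and \<open>mk\<close> that
  the preceding north step is a decorated rise, so that \<open>w\<close> does not count.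
\<close>

type_synonym row = "nat \<times> bool \<times> bool"

text \<open>A list may end only after a row without decorated peak, which encodes the condition on
  the last peak. Starting with \<open>H = 0\<close> and \<open>pv = False\<close> forces a first row
  of area \<open>0\<close> without mark. The test \<open>pv\<close> on a mark says that the
  preceding north step is not also a decorated peak.\<close>

fun valid_rows :: "nat \<Rightarrow> bool \<Rightarrow> row list \<Rightarrow> bool" where
  "valid_rows H pv [] = pv"
| "valid_rows H pv ((w, st, mk) # rs) \<longleftrightarrow>
     w \<le> H \<and> (mk \<longrightarrow> pv \<and> w = H) \<and> valid_rows (w + of_bool (\<not> st)) (\<not> st) rs"

text \<open>Instead of numbering blocks, each break adds one for every row from the break
  onwards.\<close>

fun rows_bounce :: "nat \<Rightarrow> row list \<Rightarrow> nat" where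
  "rows_bounce s [] = 0"
| "rows_bounce s ((w, st, mk) # rs) =
     (if w < s then Suc (length rs) + rows_bounce (of_bool (\<not> st)) rs
      else rows_bounce (s + of_bool (\<not> st)) rs)"

definition rows_area :: "row list \<Rightarrow> nat" where
  "rows_area rs = (\<Sum>(w, st, mk)\<leftarrow>rs. if mk then 0 else w)"

definition starred :: "row list \<Rightarrow> nat" where
  "starred rs = length (filter (\<lambda>r. fst (snd r)) rs)"

definition marked :: "row list \<Rightarrow> nat" where
  "marked rs = length (filter (\<lambda>r. snd (snd r)) rs)"

definition row_lists :: "nat \<Rightarrow> nat \<Rightarrow> bool \<Rightarrow> row list set" where
  "row_lists n H pv = {rs. length rs = n \<and> valid_rows H pv rs}"

definition rows_weight :: "real \<Rightarrow> real \<Rightarrow> real \<Rightarrow> real \<Rightarrow> nat \<Rightarrow> row list \<Rightarrow> real" where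
  "rows_weight q t x z s rs =
     q ^ rows_area rs * t ^ rows_bounce s rs * x ^ starred rs * z ^ marked rs"

definition row_steps :: "nat \<Rightarrow> nat \<Rightarrow> bool \<Rightarrow> (nat \<times> bool \<times> bool \<times> row list) set" where
  "row_steps n H pv = (SIGMA w:{..H}. SIGMA st:UNIV. SIGMA mk:{mk. mk \<longrightarrow> pv \<and> w = H}.
     row_lists n (w + of_bool (\<not> st)) (\<not> st))"

lemma row_lists_Suc:
  "row_lists (Suc n) H pv = (\<lambda>(w, st, mk, rs). (w, st, mk) # rs) ` row_steps n H pv"
proof (intro set_eqI)
  fix rs
  show "rs \<in> row_lists (Suc n) H pv \<longleftrightarrow> rs \<in> (\<lambda>(w, st, mk, rs). (w, st, mk) # rs) ` row_steps n H pv"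
  proof (cases rs)
    case Nil
    then show ?thesis by (auto simp: row_lists_def)
  next
    case (Cons r rs')
    obtain w st mk where r: "r = (w, st, mk)" by (cases r)
    have "rs \<in> (\<lambda>(w, st, mk, rs). (w, st, mk) # rs) ` row_steps n H pv \<longleftrightarrow> (w, st, mk, rs') \<in> row_steps n H pv"
      unfolding Cons r by (auto simp: image_iff split: prod.splits)
    also have "\<dots> \<longleftrightarrow> rs \<in> row_lists (Suc n) H pv"
      unfolding Cons r row_lists_def row_steps_def by (simp only: mem_Sigma_iff mem_Collect_eq valid_rows.simps list.size atMost_iff UNIV_I) auto
    finally show ?thesis ..
  qed
qed

lemma finite_row_lists: "finite (row_lists n H pv)"
proof (induction n arbitrary: H pv)
  case 0
  have "row_lists 0 H pv \<subseteq> {[]}" by (auto simp: row_lists_def)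
  then show ?case using finite_subset by blast
next
  case (Suc n)
  then show ?case unfolding row_lists_Suc row_steps_def by (intro finite_imageI finite_SigmaI) auto
qed

lemma sum_rows_weight:
  "(\<Sum>rs\<in>row_lists n H pv. rows_weight q t x z s rs) = tail_gf q t x z n H s pv"
proof (induction n arbitrary: H pv s)
  case 0
  have "row_lists 0 H pv = (if pv then {[]} else {})" by (auto simp: row_lists_def)
  then show ?case by (simp add: rows_weight_def rows_area_def starred_def marked_def)
next
  case (Suc n)
  define V where "V w st = row_lists n (w + of_bool (\<not> st)) (\<not> st)" for w st
  define M where "M w = {mk. mk \<longrightarrow> pv \<and> w = H}" for w
  have fV: "finite (V w st)" for w st by (simp add: V_def finite_row_lists)
  define G where "G w st mk rs = rows_weight q t x z s ((w, st, mk) # rs)" for w st mk rs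
  have inj: "inj_on (\<lambda>(w, st, mk, rs). (w, st, mk) # rs) (row_steps n H pv)"
    by (auto simp: inj_on_def)
  have "(\<Sum>rs\<in>row_lists (Suc n) H pv. rows_weight q t x z s rs)
      = (\<Sum>(w, st, mk, rs)\<in>row_steps n H pv. G w st mk rs)"
    unfolding row_lists_Suc sum.reindex[OF inj] by (simp add: G_def case_prod_unfold o_def)
  also have "\<dots> = (\<Sum>w\<le>H. \<Sum>st\<in>UNIV. \<Sum>mk\<in>M w. \<Sum>rs\<in>V w st. G w st mk rs)"
    unfolding row_steps_def V_def[symmetric] M_def[symmetric]
    by (simp add: sum.Sigma fV finite_SigmaI)
  also have "\<dots> = tail_gf q t x z (Suc n) H s pv"
    unfolding tail_gf.simps
  proof (rule sum.cong[OF refl])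
    fix w
    define c where "c = (if w < s then t ^ Suc n else 1)"
    define s' where "s' = (if w < s then 0 else s)"
    have G: "G w st mk rs = (if mk then z else q ^ w) * c * (if st then x else 1)
        * rows_weight q t x z (s' + of_bool (\<not> st)) rs" if "rs \<in> V w st" for st mk rs
      using that by (auto simp: G_def rows_weight_def c_def s'_def rows_area_def starred_def marked_def V_def
          row_lists_def power_add)
    have S: "(\<Sum>rs\<in>V w st. G w st mk rs) = (if mk then z else q ^ w) * c * (if st then x else 1)
        * tail_gf q t x z n (w + of_bool (\<not> st)) (s' + of_bool (\<not> st)) (\<not> st)" for st mk
      unfolding Suc.IH[symmetric] V_def[symmetric] sum_distrib_left by (intro sum.cong) (auto simp: G)
    have M: "M w = (if pv \<and> w = H then {False, True} else {False})" by (auto simp: M_def)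
    show "(\<Sum>st\<in>UNIV. \<Sum>mk\<in>M w. \<Sum>rs\<in>V w st. G w st mk rs) =
      (q ^ w + (if pv \<and> w = H then z else 0)) *
     (if w < s then t ^ Suc n * (tail_gf q t x z n (Suc w) 1 True + x * tail_gf q t x z n w 0 False)
      else tail_gf q t x z n (Suc w) (Suc s) True + x * tail_gf q t x z n w s False)"
      unfolding S M by (auto simp: UNIV_bool c_def s'_def algebra_simps)
  qed
  finally show ?case .
qed

section \<open>From generating functions to cardinalities and bijections\<close>

lemma coefficients_eqI:
  fixes c :: "'a \<Rightarrow> real" and d :: "'b \<Rightarrow> real"
  assumes fin: "finite A" "finite B"
    and eq: "\<And>v. 0 < v \<Longrightarrow> v < 1 \<Longrightarrow> (\<Sum>a\<in>A. c a * v ^ f a) = (\<Sum>b\<in>B. d b * v ^ g b)"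
  shows "(\<Sum>a | a \<in> A \<and> f a = k. c a) = (\<Sum>b | b \<in> B \<and> g b = k. d b)"
proof -
  define p where "p = (\<Sum>a\<in>A. monom (c a) (f a)) - (\<Sum>b\<in>B. monom (d b) (g b))"
  have "poly p v = 0" if "v \<in> {0<..<1}" for v
    using eq[of v] that by (simp add: p_def poly_sum poly_monom)
  then have "{0<..<1} \<subseteq> {v. poly p v = 0}" by auto
  moreover have "infinite {0<..<1::real}" by (simp add: infinite_Ioo)
  ultimately have "p = 0" using poly_roots_finite finite_subset by blast
  then have "coeff p k = 0" by simp
  then have "(\<Sum>a\<in>A. if f a = k then c a else 0) = (\<Sum>b\<in>B. if g b = k then d b else 0)"
    by (simp add: p_def coeff_sum coeff_monom)
  moreover have "(\<Sum>a | a \<in> A \<and> f a = k. c a) = (\<Sum>a\<in>A. if f a = k then c a else 0)"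
    using fin(1) by (intro sum.mono_neutral_cong_left) auto
  moreover have "(\<Sum>b | b \<in> B \<and> g b = k. d b) = (\<Sum>b\<in>B. if g b = k then d b else 0)"
    using fin(2) by (intro sum.mono_neutral_cong_left) auto
  ultimately show ?thesis by simp
qed

text \<open>Coefficients are extracted in one variable at a time, in the order \<open>q\<close>,
  \<open>t\<close>, \<open>x\<close>, \<open>z\<close>, the others being positive parameters.
  Agreement on the open unit interval suffices, as a nonzero polynomial has finitely many
  roots.\<close>

lemma card_row_lists_symmetric:
  "card {rs \<in> row_lists n 0 False. rows_area rs = \<alpha> \<and> rows_bounce 0 rs = \<beta> \<and> starred rs = a \<and> marked rs = b}
   = card {rs \<in> row_lists n 0 False. rows_area rs = \<alpha> \<and> rows_bounce 0 rs = \<beta> \<and> starred rs = b \<and> marked rs = a}"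
proof -
  let ?V = "row_lists n 0 False"
  define V1 where "V1 = {rs \<in> ?V. rows_area rs = \<alpha>}"
  define V2 where "V2 = {rs \<in> V1. rows_bounce 0 rs = \<beta>}"
  have fin: "finite ?V" "finite V1" "finite V2" by (auto simp: V1_def V2_def finite_row_lists)
  have "(\<Sum>rs\<in>?V. (t ^ rows_bounce 0 rs * x ^ starred rs * z ^ marked rs) * q ^ rows_area rs)
     = (\<Sum>rs\<in>?V. (t ^ rows_bounce 0 rs * z ^ starred rs * x ^ marked rs) * q ^ rows_area rs)"
    if "0 < q" "q < 1" "0 < x" "0 < z" for q t x z :: real
    using tail_gf_symmetric[OF that, of t n]
    unfolding sum_rows_weight[symmetric] rows_weight_def by (simp only: ac_simps)
  then have "(\<Sum>rs\<in>V1. t ^ rows_bounce 0 rs * x ^ starred rs * z ^ marked rs)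
     = (\<Sum>rs\<in>V1. t ^ rows_bounce 0 rs * z ^ starred rs * x ^ marked rs)"
    if "0 < x" "0 < z" for t x z :: real
    unfolding V1_def using that by (intro coefficients_eqI[OF fin(1) fin(1)]) auto
  then have "(\<Sum>rs\<in>V1. (x ^ starred rs * z ^ marked rs) * t ^ rows_bounce 0 rs)
     = (\<Sum>rs\<in>V1. (z ^ starred rs * x ^ marked rs) * t ^ rows_bounce 0 rs)"
    if "0 < x" "0 < z" for t x z :: real
    using that by (simp only: ac_simps)
  then have "(\<Sum>rs\<in>V2. x ^ starred rs * z ^ marked rs) = (\<Sum>rs\<in>V2. z ^ starred rs * x ^ marked rs)"
    if "0 < x" "0 < z" for x z :: real
    unfolding V2_def using that by (intro coefficients_eqI[OF fin(2) fin(2)]) auto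
  then have "(\<Sum>rs\<in>V2. z ^ marked rs * x ^ starred rs) = (\<Sum>rs\<in>V2. z ^ starred rs * x ^ marked rs)"
    if "0 < x" "0 < z" for x z :: real
    using that by (simp only: ac_simps)
  then have "(\<Sum>rs | rs \<in> V2 \<and> starred rs = a. z ^ marked rs) = (\<Sum>rs | rs \<in> V2 \<and> marked rs = a. z ^ starred rs)"
    if "0 < z" for z :: real
    using that by (intro coefficients_eqI[OF fin(3) fin(3)]) auto
  then have e: "(\<Sum>rs\<in>{rs \<in> V2. starred rs = a}. 1 * z ^ marked rs) = (\<Sum>rs\<in>{rs \<in> V2. marked rs = a}. 1 * z ^ starred rs)"
    if "0 < z" for z :: real
    using that by simp
  have "(\<Sum>rs | rs \<in> {rs \<in> V2. starred rs = a} \<and> marked rs = b. 1::real) = (\<Sum>rs | rs \<in> {rs \<in> V2. marked rs = a} \<and> starred rs = b. 1)"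
    by (rule coefficients_eqI) (use fin(3) in simp, use fin(3) in simp, rule e)
  then show ?thesis by (simp add: V2_def V1_def conj_ac)
qed

text \<open>Bijections chosen separately on the fibres are glued along \<open>f\<close>; since they
  are chosen by cardinality only, the resulting map is not explicit.\<close>

lemma bij_betw_of_card_fibres:
  assumes fin: "finite A" "finite B"
    and card: "\<And>v. card {a \<in> A. f a = v} = card {b \<in> B. g b = v}"
  shows "\<exists>h. bij_betw h A B \<and> (\<forall>a\<in>A. g (h a) = f a)"
proof -
  have "\<forall>v. \<exists>h. bij_betw h {a \<in> A. f a = v} {b \<in> B. g b = v}"
    using fin card by (auto intro!: finite_same_card_bij)
  from choice[OF this] obtain h where h: "\<And>v. bij_betw (h v) {a \<in> A. f a = v} {b \<in> B. g b = v}" by blast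
  define k where "k a = h (f a) a" for a
  have k: "k a \<in> B \<and> g (k a) = f a" if "a \<in> A" for a
    using bij_betwE[OF h[of "f a"]] that by (auto simp: k_def)
  have "inj_on k A"
  proof (rule inj_onI)
    fix a a' assume a: "a \<in> A" "a' \<in> A" "k a = k a'"
    then have "f a = f a'" using k by metis
    then show "a = a'" using a h[of "f a"] by (auto simp: k_def bij_betw_def inj_on_def)
  qed
  moreover have "b \<in> k ` A" if "b \<in> B" for b
  proof -
    have "b \<in> h (g b) ` {a \<in> A. f a = g b}"
      using h[of "g b"] that by (simp add: bij_betw_def)
    then obtain a where "a \<in> A" "b = k a" by (auto simp: k_def)
    then show ?thesis by blast
  qed
  ultimately show ?thesis using k by (auto simp: bij_betw_def)
qed

section \<open>Paths and their columns\<close>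

abbreviation norths :: "step list \<Rightarrow> nat" where "norths p \<equiv> count_list p North"
abbreviation easts :: "step list \<Rightarrow> nat" where "easts p \<equiv> count_list p East"

definition north_cols :: "step list \<Rightarrow> nat list" where
  "north_cols p = map (\<lambda>k. easts (take k p)) (filter (\<lambda>k. p ! k = North) [0..<length p])"

text \<open>
  \<open>cols p ! j\<close> is the abscissa of the north step in row \<open>j + 1\<close>; the final entry bounds the east steps
  above the last row.
\<close>

definition cols :: "step list \<Rightarrow> nat list" where
  "cols p = north_cols p @ [easts p]"

lemma length_norths_easts: "length p = easts p + norths p"
proof (induction p)
  case (Cons s p) then show ?case by (cases s) auto
qed simp

lemma north_cols_Nil [simp]: "north_cols [] = []"
  by (simp add: north_cols_def)

lemma north_cols_snoc [simp]:
  "north_cols (p @ [s]) = north_cols p @ (if s = North then [easts p] else [])"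
proof -
  have "filter (\<lambda>k. (p @ [s]) ! k = North) [0..<length p] = filter (\<lambda>k. p ! k = North) [0..<length p]"
    by (rule filter_cong) (auto simp: nth_append)
  then show ?thesis by (auto simp: north_cols_def)
qed

lemma length_north_cols [simp]: "length (north_cols p) = norths p"
  by (induction p rule: rev_induct) auto

lemma cols_last [simp]: "cols p ! norths p = easts p"
  using nth_append_length[of "north_cols p" "easts p" "[]"] by (simp add: cols_def)

lemma cols_snoc:
  "h \<le> norths p \<Longrightarrow> cols (p @ [s]) ! h = (if s = East \<and> h = norths p then Suc (easts p) else cols p ! h)"
  by (cases s) (auto simp: cols_def nth_append)

lemma cols_le: "h \<le> norths p \<Longrightarrow> cols p ! h \<le> easts p"
proof (induction p arbitrary: h rule: rev_induct)
  case (snoc s p)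
  show ?case
  proof (cases "h \<le> norths p")
    case True
    then show ?thesis using snoc.IH[of h] by (cases s) (auto simp: cols_snoc)
  next
    case False
    then have "h = norths (p @ [s])" using snoc.prems by (cases s) auto
    then show ?thesis by (simp only: cols_last)
  qed
qed (simp add: cols_def)

lemma cols_mono_Suc: "h < norths p \<Longrightarrow> cols p ! h \<le> cols p ! Suc h"
proof (induction p arbitrary: h rule: rev_induct)
  case (snoc s p)
  show ?case
  proof (cases "h < norths p")
    case True
    then show ?thesis using snoc.IH[of h] cols_le[of h p] by (auto simp: cols_snoc)
  next
    case False
    then have h: "s = North" "h = norths p" using snoc.prems by (cases s; auto)+
    then have "Suc h = norths (p @ [s])" by simp
    then have "cols (p @ [s]) ! Suc h = easts (p @ [s])" by (simp only: cols_last)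
    then show ?thesis using h by (simp add: cols_snoc)
  qed
qed simp

lemma is_north_step_snoc:
  "is_north_step (p @ [s]) i k \<longleftrightarrow>
     is_north_step p i k \<or> s = North \<and> k = length p \<and> i = Suc (norths p)"
  by (cases "k < length p") (auto simp: is_north_step_def nth_append less_Suc_eq)

text \<open>The north step of row \<open>j + 1\<close> is preceded by \<open>j\<close> north and
  \<open>cols p ! j\<close> east steps, and its position is their sum.\<close>

lemma is_north_step_iff:
  "is_north_step p i k \<longleftrightarrow> (\<exists>j<norths p. i = Suc j \<and> k = cols p ! j + j)"
proof (induction p arbitrary: i k rule: rev_induct)
  case Nil
  then show ?case by (simp add: is_north_step_def)
next
  case (snoc s p)
  show ?case
  proof (cases s)
    case North
    have "(\<exists>j<Suc (norths p). i = Suc j \<and> k = cols (p @ [s]) ! j + j) \<longleftrightarrow>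
      (\<exists>j<norths p. i = Suc j \<and> k = cols (p @ [s]) ! j + j) \<or> (i = Suc (norths p) \<and> k = cols (p @ [s]) ! norths p + norths p)"
      by (auto simp: less_Suc_eq)
    then show ?thesis
      using snoc North by (simp add: is_north_step_snoc cols_snoc length_norths_easts cong: conj_cong)
        (metis)
  next
    case East
    then show ?thesis using snoc by (simp add: is_north_step_snoc cols_snoc cong: conj_cong)
  qed
qed

lemma is_north_step_easts:
  "is_north_step p i k \<Longrightarrow> easts (take k p) = cols p ! (i - 1) \<and> norths (take k p) = i - 1"
proof -
  assume k: "is_north_step p i k"
  then have "norths (take k p) = i - 1" by (auto simp: is_north_step_def take_Suc_conv_app_nth)
  moreover have "k = cols p ! (i - 1) + (i - 1)" using k unfolding is_north_step_iff by auto
  moreover have "k = easts (take k p) + norths (take k p)"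
    using k length_norths_easts[of "take k p"] by (simp add: is_north_step_def)
  ultimately show ?thesis by simp
qed

definition east_at :: "step list \<Rightarrow> nat \<Rightarrow> nat \<Rightarrow> bool" where
  "east_at p c h \<longleftrightarrow> (\<exists>k<length p. p ! k = East \<and> easts (take k p) = c \<and> norths (take k p) = h)"

lemma east_at_snoc:
  "east_at (p @ [s]) c h \<longleftrightarrow> east_at p c h \<or> s = East \<and> c = easts p \<and> h = norths p"
proof
  assume "east_at (p @ [s]) c h"
  then obtain k where k: "k < Suc (length p)" "(p @ [s]) ! k = East"
    "easts (take k (p @ [s])) = c" "norths (take k (p @ [s])) = h" by (auto simp: east_at_def)
  show "east_at p c h \<or> s = East \<and> c = easts p \<and> h = norths p"
  proof (cases "k = length p")
    case True
    then show ?thesis using k by simp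
  next
    case False
    then have "k < length p" using k by simp
    then show ?thesis using k by (auto simp: nth_append east_at_def)
  qed
next
  assume "east_at p c h \<or> s = East \<and> c = easts p \<and> h = norths p"
  then show "east_at (p @ [s]) c h"
  proof
    assume "east_at p c h"
    then obtain k where "k < length p" "p ! k = East" "easts (take k p) = c" "norths (take k p) = h"
      by (auto simp: east_at_def)
    then show ?thesis unfolding east_at_def by (intro exI[of _ k]) (simp add: nth_append)
  next
    assume "s = East \<and> c = easts p \<and> h = norths p"
    then show ?thesis unfolding east_at_def by (intro exI[of _ "length p"]) simp
  qed
qed

text \<open>At height \<open>h\<close> the path runs between the columns of the adjacent rows; the
  guard \<open>0 < h\<close> covers the bottom and the final entry of \<open>cols\<close> the
  top.\<close>

lemma east_at_iff:
  "east_at p c h \<longleftrightarrow> h \<le> norths p \<and> (0 < h \<longrightarrow> cols p ! (h - 1) \<le> c) \<and> c < cols p ! h"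
proof (induction p arbitrary: c h rule: rev_induct)
  case Nil
  show ?case
  proof (cases "h = 0")
    case True
    then show ?thesis by (simp add: east_at_def cols_def)
  qed (simp add: east_at_def)
next
  case (snoc s p)
  note e = east_at_snoc[of p s c h]
  have "s = North \<and> h = Suc (norths p) \<or> h \<le> norths p \<or> h > norths (p @ [s])"
    by (cases s) auto
  then consider "s = North" "h = Suc (norths p)" | "h \<le> norths p" | "h > norths (p @ [s])"
    by blast
  then show ?case
  proof cases
    case 1
    then have "h = norths (p @ [s])" by simp
    then have "cols (p @ [s]) ! h = easts (p @ [s])" by (simp only: cols_last)
    then show ?thesis using 1 unfolding e snoc.IH by (auto simp: cols_snoc)
  next
    case 2
    have prev: "cols (p @ [s]) ! (h - 1) = cols p ! (h - 1)" "cols p ! (h - 1) \<le> easts p" if "0 < h"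
      using that 2 cols_snoc[of "h - 1" p s] cols_le[of "h - 1" p] by auto
    show ?thesis
    proof (cases "s = East \<and> h = norths p")
      case True
      then have "cols (p @ [s]) ! h = Suc (easts p)" "cols p ! h = easts p" by (simp_all add: cols_snoc)
      then show ?thesis using True prev unfolding e snoc.IH by auto
    next
      case False
      then have "cols (p @ [s]) ! h = cols p ! h" using 2 by (auto simp: cols_snoc)
      then show ?thesis using False 2 prev unfolding e snoc.IH by auto
    qed
  next
    case 3
    then show ?thesis unfolding e snoc.IH by auto
  qed
qed

lemma easts_le_cols: "k \<le> length p \<Longrightarrow> easts (take k p) \<le> cols p ! norths (take k p)"
proof (induction p arbitrary: k rule: rev_induct)
  case (snoc s p)
  show ?case
  proof (cases "k \<le> length p")
    case True
    have "norths (take k p) \<le> norths p"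
      by (metis append_take_drop_id count_list_append le_add1)
    moreover have "cols p ! norths p = easts p" by simp
    ultimately show ?thesis using True snoc.IH[of k] by (auto simp: cols_snoc)
  next
    case False
    then have "take k (p @ [s]) = p @ [s]" using snoc.prems by simp
    then show ?thesis by (simp only: cols_last)
  qed
qed simp

text \<open>At height \<open>j\<close> the number of east steps is largest at the end of that level,
  where it equals \<open>cols p ! j\<close>; only these points need checking.\<close>

lemma dyck_path_iff:
  "dyck_path n p \<longleftrightarrow> norths p = n \<and> easts p = n \<and> (\<forall>j\<le>n. cols p ! j \<le> j)"
proof
  assume p: "dyck_path n p"
  have "cols p ! j \<le> j" if j: "j < n" for j
  proof -
    have "is_north_step p (Suc j) (cols p ! j + j)"
      using j p by (auto simp: is_north_step_iff dyck_path_def)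
    from is_north_step_easts[OF this] this show ?thesis
      using p unfolding dyck_path_def is_north_step_def by (metis diff_Suc_1 less_imp_le)
  qed
  moreover have "cols p ! n \<le> n" using p by (metis cols_last dyck_path_def order_refl)
  ultimately show "norths p = n \<and> easts p = n \<and> (\<forall>j\<le>n. cols p ! j \<le> j)"
    using p by (auto simp: dyck_path_def le_less)
next
  assume p: "norths p = n \<and> easts p = n \<and> (\<forall>j\<le>n. cols p ! j \<le> j)"
  have "norths (take k p) \<le> norths p" for k
    by (metis append_take_drop_id count_list_append le_add1)
  then show "dyck_path n p"
    using p easts_le_cols unfolding dyck_path_def by (metis order_trans)
qed

lemma peaks_iff: "Suc j \<in> peaks p \<longleftrightarrow> j < norths p \<and> cols p ! j < cols p ! Suc j"
proof -
  have "Suc j \<in> peaks p \<longleftrightarrow> j < norths p \<and> east_at p (cols p ! j) (Suc j)"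
  proof
    assume "Suc j \<in> peaks p"
    then obtain k where k: "is_north_step p (Suc j) k" "Suc k < length p" "p ! Suc k = East"
      by (auto simp: peaks_def)
    moreover have "take (Suc k) p = take k p @ [North]"
      using k(1) by (auto simp: is_north_step_def take_Suc_conv_app_nth)
    ultimately show "j < norths p \<and> east_at p (cols p ! j) (Suc j)"
      using is_north_step_easts[OF k(1)] by (auto simp: east_at_def is_north_step_iff)
  next
    assume j: "j < norths p \<and> east_at p (cols p ! j) (Suc j)"
    then obtain k where k: "k < length p" "p ! k = East" "easts (take k p) = cols p ! j" "norths (take k p) = Suc j"
      by (auto simp: east_at_def)
    then have "k = Suc (cols p ! j + j)" using length_norths_easts[of "take k p"] by simp
    then show "Suc j \<in> peaks p" using j k by (auto simp: peaks_def is_north_step_iff)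
  qed
  then show ?thesis by (auto simp: east_at_iff)
qed

text \<open>The final entry of \<open>cols\<close> belongs to no north step, so equality with it is
  not a rise; hence the bound on \<open>Suc j\<close>, where peaks need only a bound on
  \<open>j\<close>.\<close>

lemma rises_iff: "Suc j \<in> rises p \<longleftrightarrow> Suc j < norths p \<and> cols p ! j = cols p ! Suc j"
proof
  assume "Suc j \<in> rises p"
  then obtain k where k: "is_north_step p (Suc j) k" "Suc k < length p" "p ! Suc k = North"
    by (auto simp: rises_def)
  then have "is_north_step p (Suc (Suc j)) (Suc k)"
    by (auto simp: is_north_step_def take_Suc_conv_app_nth[of "Suc k"])
  with k(1) show "Suc j < norths p \<and> cols p ! j = cols p ! Suc j" by (auto simp: is_north_step_iff)
next
  assume j: "Suc j < norths p \<and> cols p ! j = cols p ! Suc j"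
  then have "is_north_step p (Suc j) (cols p ! j + j)" "is_north_step p (Suc (Suc j)) (Suc (cols p ! j + j))"
    by (auto simp: is_north_step_iff)
  then show "Suc j \<in> rises p" unfolding rises_def
    by (intro CollectI exI[of _ "cols p ! j + j"]) (simp add: is_north_step_def)
qed

lemma peaks_subset: "peaks p \<subseteq> Suc ` {..<norths p}"
  unfolding peaks_def is_north_step_iff by auto

lemma rises_subset: "rises p \<subseteq> Suc ` {..<norths p}"
  unfolding rises_def is_north_step_iff by auto

lemma area_word_eq: "j < norths p \<Longrightarrow> area_word p (Suc j) = j - cols p ! j"
proof -
  assume j: "j < norths p"
  have "is_north_step p (Suc j) k \<Longrightarrow> easts (take k p) = cols p ! j" for k
    using is_north_step_easts by fastforce
  moreover have "is_north_step p (Suc j) (cols p ! j + j)" using j by (auto simp: is_north_step_iff)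
  ultimately have "{x. \<exists>k. is_north_step p (Suc j) k \<and> easts (take k p) \<le> x \<and> x + 1 \<le> Suc j - 1}
     = {cols p ! j..<j}" by auto
  then show ?thesis by (simp add: area_word_def)
qed

section \<open>Reconstruction of a path from its columns\<close>

lemma path_unique: "north_cols p = north_cols p' \<Longrightarrow> easts p = easts p' \<Longrightarrow> p = p'"
proof (induction p arbitrary: p' rule: rev_induct)
  case Nil
  then have "length p' = 0" using length_norths_easts[of p'] length_north_cols[of p'] by (simp del: length_north_cols)
  then show ?case by simp
next
  case (snoc s p)
  have le: "c \<in> set (north_cols q) \<Longrightarrow> c \<le> easts q" for c q
  proof -
    assume "c \<in> set (north_cols q)"
    then obtain j where "j < norths q" "c = north_cols q ! j" by (metis in_set_conv_nth length_north_cols)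
    then show "c \<le> easts q" using cols_le[of j q] by (simp add: cols_def nth_append)
  qed
  show ?case
  proof (cases p' rule: rev_cases)
    case Nil
    have "length (p @ [s]) = 0"
      using snoc.prems length_norths_easts[of "p @ [s]"] length_north_cols[of "p @ [s]"] unfolding Nil
      by (simp del: length_north_cols north_cols_snoc)
    then show ?thesis by simp
  next
    case (snoc p'' s')
    show ?thesis
    proof (cases s; cases s')
      assume "s = North" "s' = North"
      then show ?thesis using snoc.IH snoc.prems snoc by simp
    next
      assume "s = East" "s' = East"
      then show ?thesis using snoc.IH snoc.prems snoc by simp
    next
      \<comment> \<open>A path ending in a north step has a column equal to its total number of east
        steps, whereas one ending in an east step has only smaller columns.\<close>
      assume s: "s = North" "s' = East"
      then have "north_cols p'' = north_cols p @ [easts p]" "easts p = Suc (easts p'')"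
        using snoc.prems snoc by auto
      then show ?thesis using le[of "easts p" p''] by simp
    next
      assume s: "s = East" "s' = North"
      then have "north_cols p = north_cols p'' @ [easts p'']" "easts p'' = Suc (easts p)"
        using snoc.prems snoc by auto
      then show ?thesis using le[of "easts p''" p] by simp
    qed
  qed
qed

lemma path_exists:
  "sorted xs \<Longrightarrow> \<forall>x\<in>set xs. x \<le> m \<Longrightarrow> \<exists>p. north_cols p = xs \<and> easts p = m"
proof (induction xs arbitrary: m rule: rev_induct)
  case Nil
  have "north_cols (replicate m East) = [] \<and> easts (replicate m East) = m"
  proof (induction m)
    case (Suc m)
    have e: "replicate (Suc m) East = replicate m East @ [East]" by (simp add: replicate_append_same)
    show ?case unfolding e north_cols_snoc count_list_append using Suc.IH by simp
  qed simp
  then show ?case by blast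
next
  case (snoc x xs)
  then obtain p where p: "north_cols p = xs" "easts p = x" by (auto simp: sorted_append)
  have "north_cols (p @ [North] @ replicate l East) = xs @ [x] \<and> easts (p @ [North] @ replicate l East) = x + l" for l
  proof (induction l)
    case 0 then show ?case using p by simp
  next
    case (Suc l)
    have e: "p @ [North] @ replicate (Suc l) East = (p @ [North] @ replicate l East) @ [East]"
      by (simp add: replicate_append_same)
    show ?case unfolding e north_cols_snoc[of "p @ [North] @ replicate l East"] using Suc.IH by simp
  qed
  from this[of "m - x"] show ?case using snoc.prems by auto
qed

section \<open>The second bounce path\<close>

lemma east_step_starts_snoc:
  "east_step_starts (q @ [s]) = east_step_starts q \<union> (if s = East then {(easts q, norths q)} else {})"
proof -
  have "east_step_starts r = {(c, h). east_at r c h}" for r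
    unfolding east_step_starts_def east_at_def by blast
  then show ?thesis by (auto simp: east_at_snoc)
qed

lemma count_list_nths: "count_list (nths p A) s = card {j. j < length p \<and> j \<in> A \<and> p ! j = s}"
proof (induction p rule: rev_induct)
  case (snoc u p)
  have fin: "finite {j. j < length p \<and> j \<in> A \<and> p ! j = s}" by simp
  have "{j. j < length (p @ [u]) \<and> j \<in> A \<and> (p @ [u]) ! j = s} =
     (if length p \<in> A \<and> u = s then insert (length p) {j. j < length p \<and> j \<in> A \<and> p ! j = s}
      else {j. j < length p \<and> j \<in> A \<and> p ! j = s})"
    by (auto simp: nth_append less_Suc_eq)
  then show ?case using snoc fin by (auto simp: nths_append)
qed simp

lemma east_step_starts_nths:
  "east_step_starts (nths p A) = {(card {j. j < k \<and> j \<in> A \<and> p ! j = East}, card {j. j < k \<and> j \<in> A \<and> p ! j = North})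
     | k. k < length p \<and> k \<in> A \<and> p ! k = East}"
proof (induction p rule: rev_induct)
  case Nil
  then show ?case by (simp add: east_step_starts_def)
next
  case (snoc s p)
  have nths: "nths (p @ [s]) A = nths p A @ (if length p \<in> A then [s] else [])"
    by (simp add: nths_append)
  define F where "F r k = (card {j. j < k \<and> j \<in> A \<and> r ! j = East}, card {j. j < k \<and> j \<in> A \<and> r ! j = North})" for r k
  define E where "E r = {F r k | k. k < length r \<and> k \<in> A \<and> r ! k = East}" for r
  have c: "{j. j < k \<and> j \<in> A \<and> (p @ [s]) ! j = u} = {j. j < k \<and> j \<in> A \<and> p ! j = u}"
    if "k \<le> length p" for k u
    using that by (intro Collect_cong) (auto simp: nth_append)
  have F: "F (p @ [s]) k = F p k" if "k \<le> length p" for k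
    unfolding F_def c[OF that] ..
  have "E (p @ [s]) = {F p k | k. k < Suc (length p) \<and> k \<in> A \<and> (p @ [s]) ! k = East}"
    unfolding E_def length_append_singleton by (intro Collect_cong) (metis F less_Suc_eq_le)
  also have "\<dots> = {F p k | k. k < length p \<and> k \<in> A \<and> (p @ [s]) ! k = East}
      \<union> {F p k | k. k = length p \<and> k \<in> A \<and> (p @ [s]) ! k = East}"
    unfolding less_Suc_eq by blast
  also have "{F p k | k. k < length p \<and> k \<in> A \<and> (p @ [s]) ! k = East} = E p"
    unfolding E_def by (intro Collect_cong) (metis nth_append)
  also have "{F p k | k. k = length p \<and> k \<in> A \<and> (p @ [s]) ! k = East}
      = (if length p \<in> A \<and> s = East then {(easts (nths p A), norths (nths p A))} else {})"
    by (auto simp: count_list_nths F_def)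
  finally have "E (p @ [s]) = E p \<union> (if length p \<in> A \<and> s = East then {(easts (nths p A), norths (nths p A))} else {})" .
  moreover have "east_step_starts (nths p A) = E p" using snoc by (simp add: E_def F_def)
  ultimately have "east_step_starts (nths (p @ [s]) A) = E (p @ [s])"
    unfolding nths by (simp add: east_step_starts_snoc)
  then show ?case by (simp add: E_def F_def)
qed

text \<open>\<open>red_col D j\<close> is the abscissa, in the reduced path, of the north step in row \<open>j + 1\<close>.\<close>

definition decs :: "decorated_path \<Rightarrow> nat \<Rightarrow> nat" where
  "decs D j = card {i \<in> Peak D. i \<le> j}"

definition red_col :: "decorated_path \<Rightarrow> nat \<Rightarrow> nat" where
  "red_col D j = cols (path D) ! j - decs D j"

definition row_of :: "decorated_path \<Rightarrow> nat \<Rightarrow> row" where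
  "row_of D j = (area_word (path D) (Suc j), Suc j \<in> Peak D, j \<in> Rise D)"

lemma decorated_dyck_barD:
  assumes "D \<in> decorated_dyck_bar n a b"
  shows "norths (path D) = n" "easts (path D) = n" "\<And>j. j \<le> n \<Longrightarrow> cols (path D) ! j \<le> j"
    "size_of D = n" "Peak D \<subseteq> peaks (path D)" "Rise D \<subseteq> rises (path D)" "n \<notin> Peak D"
    "card (Peak D) = a" "card (Rise D) = b" "finite (Peak D)" "finite (Rise D)"
    "\<And>i. i \<in> Peak D \<Longrightarrow> 0 < i \<and> i < n"
proof -
  show N: "norths (path D) = n" and "easts (path D) = n" and "\<And>j. j \<le> n \<Longrightarrow> cols (path D) ! j \<le> j"
    and "size_of D = n" and P: "Peak D \<subseteq> peaks (path D)" and R: "Rise D \<subseteq> rises (path D)" and nP: "n \<notin> Peak D"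
    and "card (Peak D) = a" and "card (Rise D) = b"
    using assms by (auto simp: decorated_dyck_bar_def decorated_dyck_def dyck_path_iff size_of_def)
  show "finite (Peak D)" using P peaks_subset by (meson finite_imageI finite_lessThan finite_subset)
  show "finite (Rise D)" using R rises_subset by (meson finite_imageI finite_lessThan finite_subset)
  show "0 < i \<and> i < n" if "i \<in> Peak D" for i
  proof -
    have "i \<in> Suc ` {..<n}" using that P peaks_subset N by blast
    moreover have "i \<noteq> n" using that nP by auto
    ultimately show ?thesis by auto
  qed
qed

context
  fixes D n a b
  assumes D: "D \<in> decorated_dyck_bar n a b"
begin

private lemmas DD = decorated_dyck_barD[OF D]

lemma decs_Suc: "decs D (Suc j) = decs D j + of_bool (Suc j \<in> Peak D)"
proof -
  have "{i \<in> Peak D. i \<le> Suc j} = (if Suc j \<in> Peak D then insert (Suc j) {i \<in> Peak D. i \<le> j} else {i \<in> Peak D. i \<le> j})"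
    by (auto simp: le_Suc_eq)
  then show ?thesis using DD(10) by (simp add: decs_def)
qed

lemma decs_0: "decs D 0 = 0"
proof -
  have "{i \<in> Peak D. i \<le> 0} = {}" using DD(12) by auto
  then show ?thesis by (simp add: decs_def)
qed

lemma decs_n: "decs D n = a"
proof -
  have "{i \<in> Peak D. i \<le> n} = Peak D" using DD(12) less_imp_le by blast
  then show ?thesis using DD(8) by (simp add: decs_def)
qed

lemma cols_Suc: "j < n \<Longrightarrow> cols (path D) ! j + of_bool (Suc j \<in> Peak D) \<le> cols (path D) ! Suc j"
  using cols_mono_Suc[of j "path D"] peaks_iff[of j "path D"] DD(1,5) by auto

lemma decs_le_cols: "j \<le> n \<Longrightarrow> decs D j \<le> cols (path D) ! j"
proof (induction j)
  case (Suc j)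
  then show ?case using cols_Suc[of j] by (simp add: decs_Suc)
qed (simp add: decs_0)

lemma red_col_le: "j \<le> n \<Longrightarrow> red_col D j \<le> j - decs D j"
  using DD(3)[of j] by (simp add: red_col_def)

lemma red_col_n: "red_col D n = n - decs D n"
  using DD(1,2) cols_last[of "path D"] by (simp add: red_col_def)

lemma decs_le: "j \<le> n \<Longrightarrow> decs D j \<le> j"
  using decs_le_cols[of j] DD(3)[of j] by simp

lemma diag_mono: "i \<le> j \<Longrightarrow> j \<le> n \<Longrightarrow> i - decs D i \<le> j - decs D j"
proof (induction j rule: dec_induct)
  case (step j) then show ?case using decs_le[of j] by (auto simp: decs_Suc)
qed simp

text \<open>Row \<open>n\<close> has no decorated peak, so the diagonal advances in its last
  segment. Hence the last vertical run of the bounce path stops at a genuine east step at height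
  \<open>n\<close>.\<close>

lemma diag_less_n: "j < n \<Longrightarrow> j - decs D j < n - decs D n"
proof -
  assume j: "j < n"
  then obtain m where m: "n = Suc m" by (cases n) auto
  have "j - decs D j \<le> m - decs D m" using j m by (intro diag_mono) auto
  also have "\<dots> < n - decs D n" using DD(7) decs_le[of m] by (simp add: m decs_Suc)
  finally show ?thesis .
qed

text \<open>Each decorated peak in a row up to height \<open>h\<close> shifts the level
  \<open>h\<close> left by one. If row \<open>h\<close> itself is decorated, the first east step of
  the level disappears as well, so the level starts at \<open>red_col D (h - 1)\<close> in either
  case.\<close>

lemma reduced_starts:
  "(c, h) \<in> east_step_starts (reduced_path D) \<longleftrightarrow> 0 < h \<and> h \<le> n \<and> red_col D (h - 1) \<le> c \<and> c < red_col D h"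
proof -
  let ?p = "path D"
  define A where "A = {k. \<not> (\<exists>i \<in> Peak D. \<exists>j. is_north_step ?p i j \<and> k = Suc j)}"
  have north_pos: "is_north_step ?p i j \<longleftrightarrow> j = cols ?p ! (i - 1) + (i - 1)" if "i \<in> Peak D" for i j
    using DD(1) DD(12)[OF that] by (cases i) (auto simp: is_north_step_iff)
  have removed: "norths (take k ?p) = i \<and> easts (take k ?p) = cols ?p ! (i - 1) \<and> k < length ?p \<and> ?p ! k = East"
    if i: "i \<in> Peak D" "is_north_step ?p i j" "k = Suc j" for i j k
  proof -
    obtain j' where j': "is_north_step ?p i j'" "Suc j' < length ?p" "?p ! Suc j' = East"
      using i DD(5) by (auto simp: peaks_def)
    then have "j' = j" using i north_pos by simp
    moreover have "take (Suc j) ?p = take j ?p @ [North]"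
      using i(2) by (auto simp: is_north_step_def take_Suc_conv_app_nth)
    ultimately show ?thesis using j' is_north_step_easts[OF i(2)] DD(12)[OF i(1)] i(3) by auto
  qed
  have not_A: "norths (take k ?p) \<in> Peak D \<and> easts (take k ?p) = cols ?p ! (norths (take k ?p) - 1) \<and> k < length ?p \<and> ?p ! k = East"
    if k: "k \<notin> A" for k
  proof -
    obtain i j where "i \<in> Peak D" "is_north_step ?p i j" "k = Suc j" using k unfolding A_def by blast
    then show ?thesis using removed[of i j k] by simp
  qed
  have count: "card {j. j < k \<and> ?p ! j = s} = count_list (take k ?p) s" if "k \<le> length ?p" for k s
    using count_list_nths[of "take k ?p" UNIV s] that by (simp add: min_def nths_all cong: conj_cong)
  have norths_card: "card {j. j < k \<and> j \<in> A \<and> ?p ! j = North} = norths (take k ?p)" if "k \<le> length ?p" for k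
  proof -
    have "{j. j < k \<and> j \<in> A \<and> ?p ! j = North} = {j. j < k \<and> ?p ! j = North}"
      by (intro Collect_cong) (metis not_A step.distinct(1))
    then show ?thesis using count that by simp
  qed
  \<comment> \<open>Retention of \<open>k\<close> matters: the deleted step is the first east step
    at its height, so it precedes every retained one there, and exactly the decorated peaks up to
    the height of \<open>k\<close> have been accounted for.\<close>
  have easts_card: "card {j. j < k \<and> j \<in> A \<and> ?p ! j = East} = easts (take k ?p) - decs D (norths (take k ?p))"
    if k: "k < length ?p" "k \<in> A" for k
  proof -
    have bij: "bij_betw (\<lambda>j. norths (take j ?p)) {j. j < k \<and> j \<notin> A} {i \<in> Peak D. i \<le> norths (take k ?p)}"
    proof (rule bij_betwI')
      fix u v assume "u \<in> {j. j < k \<and> j \<notin> A}" "v \<in> {j. j < k \<and> j \<notin> A}"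
      then obtain i j i' j' where ij: "i \<in> Peak D" "is_north_step ?p i j" "u = Suc j"
         "i' \<in> Peak D" "is_north_step ?p i' j'" "v = Suc j'" unfolding A_def by blast
      then show "(norths (take u ?p) = norths (take v ?p)) = (u = v)"
        using removed[OF ij(1-3)] removed[OF ij(4-6)] north_pos[OF ij(1), of j] north_pos[OF ij(4), of j'] by metis
    next
      fix u assume u: "u \<in> {j. j < k \<and> j \<notin> A}"
      then obtain i j where ij: "i \<in> Peak D" "is_north_step ?p i j" "u = Suc j" unfolding A_def by blast
      have "take k ?p = take u ?p @ drop u (take k ?p)" using u by (metis append_take_drop_id mem_Collect_eq min.strict_order_iff min.commute take_take)
      then have "norths (take u ?p) \<le> norths (take k ?p)" by (metis count_list_append le_add1)
      then show "norths (take u ?p) \<in> {i \<in> Peak D. i \<le> norths (take k ?p)}"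
        using removed[OF ij] ij by simp
    next
      fix i assume i: "i \<in> {i \<in> Peak D. i \<le> norths (take k ?p)}"
      define j where "j = cols ?p ! (i - 1) + (i - 1)"
      have ij: "is_north_step ?p i j" using i north_pos by (simp add: j_def)
      have "\<not> k \<le> j"
      proof
        assume "k \<le> j"
        then have "take j ?p = take k ?p @ drop k (take j ?p)" by (metis append_take_drop_id min.absorb_iff2 take_take min.commute)
        then have "norths (take k ?p) \<le> norths (take j ?p)" by (metis count_list_append le_add1)
        then show False using is_north_step_easts[OF ij] i DD(12)[of i] by auto
      qed
      moreover have "k \<noteq> Suc j" using k(2) i ij unfolding A_def by blast
      ultimately have "Suc j < k" by simp
      moreover have "Suc j \<notin> A" using i ij unfolding A_def by blast
      moreover have "norths (take (Suc j) ?p) = i" using removed[of i j "Suc j"] i ij by simp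
      ultimately show "\<exists>u\<in>{j. j < k \<and> j \<notin> A}. i = norths (take u ?p)" by blast
    qed
    have "{j. j < k \<and> j \<in> A \<and> ?p ! j = East} = {j. j < k \<and> ?p ! j = East} - {j. j < k \<and> j \<notin> A}" by auto
    moreover have "{j. j < k \<and> j \<notin> A} \<subseteq> {j. j < k \<and> ?p ! j = East}" using not_A by blast
    ultimately have "card {j. j < k \<and> j \<in> A \<and> ?p ! j = East} = card {j. j < k \<and> ?p ! j = East} - card {j. j < k \<and> j \<notin> A}"
      by (simp add: card_Diff_subset)
    then show ?thesis using bij_betw_same_card[OF bij] count k by (simp add: decs_def)
  qed
  have in_A: "k \<in> A \<longleftrightarrow> \<not> (norths (take k ?p) \<in> Peak D \<and> easts (take k ?p) = cols ?p ! (norths (take k ?p) - 1))"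
    if k: "k < length ?p" for k
  proof
    assume "k \<in> A"
    show "\<not> (norths (take k ?p) \<in> Peak D \<and> easts (take k ?p) = cols ?p ! (norths (take k ?p) - 1))"
    proof
      assume h: "norths (take k ?p) \<in> Peak D \<and> easts (take k ?p) = cols ?p ! (norths (take k ?p) - 1)"
      then have "k = Suc (cols ?p ! (norths (take k ?p) - 1) + (norths (take k ?p) - 1))"
        using k length_norths_easts[of "take k ?p"] DD(12)[of "norths (take k ?p)"] by simp
      then show False using \<open>k \<in> A\<close> h north_pos unfolding A_def by blast
    qed
  next
    assume "\<not> (norths (take k ?p) \<in> Peak D \<and> easts (take k ?p) = cols ?p ! (norths (take k ?p) - 1))"
    then show "k \<in> A" using not_A by blast
  qed
  have "(c, h) \<in> east_step_starts (reduced_path D) \<longleftrightarrow>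
     (\<exists>k<length ?p. k \<in> A \<and> ?p ! k = East \<and> c = easts (take k ?p) - decs D (norths (take k ?p)) \<and> h = norths (take k ?p))"
  proof -
    have red: "reduced_path D = nths ?p A" by (simp add: reduced_path_def A_def)
    have "(c, h) \<in> east_step_starts (reduced_path D) \<longleftrightarrow> (\<exists>k<length ?p. k \<in> A \<and> ?p ! k = East
        \<and> c = card {j. j < k \<and> j \<in> A \<and> ?p ! j = East} \<and> h = card {j. j < k \<and> j \<in> A \<and> ?p ! j = North})"
      unfolding red east_step_starts_nths by blast
    moreover have "k < length ?p \<and> k \<in> A \<and> ?p ! k = East
        \<and> c = card {j. j < k \<and> j \<in> A \<and> ?p ! j = East} \<and> h = card {j. j < k \<and> j \<in> A \<and> ?p ! j = North}
      \<longleftrightarrow> k < length ?p \<and> k \<in> A \<and> ?p ! k = East \<and> c = easts (take k ?p) - decs D (norths (take k ?p)) \<and> h = norths (take k ?p)" for k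
      by (cases "k < length ?p \<and> k \<in> A") (simp only: easts_card norths_card less_imp_le, blast)
    ultimately show ?thesis by simp
  qed
  also have "\<dots> \<longleftrightarrow> (\<exists>c'. east_at ?p c' h \<and> \<not> (h \<in> Peak D \<and> c' = cols ?p ! (h - 1)) \<and> c = c' - decs D h)"
  proof
    assume "\<exists>k<length ?p. k \<in> A \<and> ?p ! k = East \<and> c = easts (take k ?p) - decs D (norths (take k ?p)) \<and> h = norths (take k ?p)"
    then obtain k where k: "k < length ?p" "k \<in> A" "?p ! k = East" "c = easts (take k ?p) - decs D h" "h = norths (take k ?p)"
      by blast
    then have "east_at ?p (easts (take k ?p)) h" unfolding east_at_def by blast
    then show "\<exists>c'. east_at ?p c' h \<and> \<not> (h \<in> Peak D \<and> c' = cols ?p ! (h - 1)) \<and> c = c' - decs D h"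
      using in_A[OF k(1)] k(2,4,5) by blast
  next
    assume "\<exists>c'. east_at ?p c' h \<and> \<not> (h \<in> Peak D \<and> c' = cols ?p ! (h - 1)) \<and> c = c' - decs D h"
    then obtain c' where c': "east_at ?p c' h" "\<not> (h \<in> Peak D \<and> c' = cols ?p ! (h - 1))" "c = c' - decs D h"
      by blast
    from c'(1) obtain k where k: "k < length ?p" "?p ! k = East" "easts (take k ?p) = c'" "norths (take k ?p) = h"
      unfolding east_at_def by blast
    have "k \<in> A" using in_A[OF k(1)] c'(2) unfolding k(3,4) by blast
    then show "\<exists>k<length ?p. k \<in> A \<and> ?p ! k = East \<and> c = easts (take k ?p) - decs D (norths (take k ?p)) \<and> h = norths (take k ?p)"
      using k c'(3) by (intro exI[of _ k]) simp
  qed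
  also have "\<dots> \<longleftrightarrow> 0 < h \<and> h \<le> n \<and> red_col D (h - 1) \<le> c \<and> c < red_col D h"
  proof (cases "0 < h \<and> h \<le> n")
    case True
    then obtain j where j: "h = Suc j" "j < n" by (cases h) auto
    have d: "decs D h = decs D j + of_bool (h \<in> Peak D)" using decs_Suc[of j] j by simp
    have le: "decs D j \<le> cols ?p ! j" using j by (intro decs_le_cols) simp
    show ?thesis
    proof
      assume "\<exists>c'. east_at ?p c' h \<and> \<not> (h \<in> Peak D \<and> c' = cols ?p ! (h - 1)) \<and> c = c' - decs D h"
      then show "0 < h \<and> h \<le> n \<and> red_col D (h - 1) \<le> c \<and> c < red_col D h"
        using True d le j by (auto simp: east_at_iff red_col_def)
    next
      assume c: "0 < h \<and> h \<le> n \<and> red_col D (h - 1) \<le> c \<and> c < red_col D h"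
      then have "east_at ?p (c + decs D h) h \<and> \<not> (h \<in> Peak D \<and> c + decs D h = cols ?p ! (h - 1)) \<and> c = c + decs D h - decs D h"
        using d le j DD(1) by (auto simp: east_at_iff red_col_def)
      then show "\<exists>c'. east_at ?p c' h \<and> \<not> (h \<in> Peak D \<and> c' = cols ?p ! (h - 1)) \<and> c = c' - decs D h" by blast
    qed
  next
    case False
    then show ?thesis using DD(1) DD(3)[of 0] by (auto simp: east_at_iff)
  qed
  finally show ?thesis .
qed

text \<open>At an inner height \<open>y\<close> two segments contribute an endpoint each; the
  endpoints differ, by one unit, exactly when row \<open>y\<close> has a decorated peak.\<close>

lemma modified_diagonal_points:
  "(real x, real y) \<in> modified_diagonal D \<longleftrightarrow>
     (0 < y \<and> y \<le> n \<and> x + decs D (y - 1) = y) \<or> (y < n \<and> x + decs D y = y)"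
proof -
  have pb: "peaks_before D (Suc j) = decs D j" for j
    by (simp add: peaks_before_def decs_def less_Suc_eq_le)
  have seg: "(real x, real y) \<in> closed_segment (real j - real e, real j) (real j + 1 - real e, real j + 1)
     \<longleftrightarrow> (y = j \<or> y = Suc j) \<and> x + e = y" for j e
  proof
    assume "(real x, real y) \<in> closed_segment (real j - real e, real j) (real j + 1 - real e, real j + 1)"
    then obtain u where u: "0 \<le> u" "u \<le> 1" "real x = (1 - u) * (real j - real e) + u * (real j + 1 - real e)"
      "real y = (1 - u) * real j + u * (real j + 1)"
      by (auto simp: in_segment)
    have "real y = real j + u" "real x + real e = real y" using u by (auto simp: algebra_simps)
    then have "real j \<le> real y" "real y \<le> real (Suc j)" "real (x + e) = real y" using u by auto
    then show "(y = j \<or> y = Suc j) \<and> x + e = y" by (simp only: of_nat_le_iff of_nat_eq_iff) auto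
  next
    assume *: "(y = j \<or> y = Suc j) \<and> x + e = y"
    then have "real x + real e = real y" by (simp flip: of_nat_add)
    then have "(real x, real y) = (real j - real e, real j) \<or> (real x, real y) = (real j + 1 - real e, real j + 1)"
      using * by auto
    then show "(real x, real y) \<in> closed_segment (real j - real e, real j) (real j + 1 - real e, real j + 1)"
      using ends_in_segment by metis
  qed
  have "(real x, real y) \<in> modified_diagonal D \<longleftrightarrow>
    (\<exists>j<n. (real x, real y) \<in> closed_segment (real j - real (decs D j), real j) (real j + 1 - real (decs D j), real j + 1))"
  proof -
    have eq: "closed_segment (real (Suc j) - 1 - real (peaks_before D (Suc j)), real (Suc j) - 1)
        (real (Suc j) - real (peaks_before D (Suc j)), real (Suc j))
      = closed_segment (real j - real (decs D j), real j) (real j + 1 - real (decs D j), real j + 1)" for j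
      by (simp add: pb add.commute)
    have "v \<in> (\<Union>i\<in>Suc ` {..<n}. S i) \<longleftrightarrow> (\<exists>j<n. v \<in> S (Suc j))" for v and S :: "nat \<Rightarrow> (real \<times> real) set"
      by auto
    then show ?thesis
      unfolding modified_diagonal_def DD(4) One_nat_def image_Suc_lessThan[unfolded One_nat_def, symmetric] eq[symmetric] .
  qed
  also have "\<dots> \<longleftrightarrow> (\<exists>j<n. (y = j \<or> y = Suc j) \<and> x + decs D j = y)" unfolding seg ..
  also have "\<dots> \<longleftrightarrow> (0 < y \<and> y \<le> n \<and> x + decs D (y - 1) = y) \<or> (y < n \<and> x + decs D y = y)"
    by (cases y) (auto simp: Suc_le_eq conj_disj_distribR conj_disj_distribL ex_disj_distrib)
  finally show ?thesis .
qed

lemma bounce_end_eq: "bounce_end D = (n - decs D n, n)"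
  using DD(4,8) decs_n by (simp add: bounce_end_def)

text \<open>Coming from the left, the path meets first the lower end of the upper segment; at
  \<open>y = n\<close> this point is \<open>bounce_end D\<close>.\<close>

lemma east_stop_eq:
  assumes "x \<le> y - decs D y" "y \<le> n"
  shows "east_stop D x y = y - decs D y"
  unfolding east_stop_def
proof (rule Least_equality)
  show "x \<le> y - decs D y \<and> ((real (y - decs D y), real y) \<in> modified_diagonal D \<or> (y - decs D y, y) = bounce_end D)"
    using assms decs_le[of y] unfolding modified_diagonal_points bounce_end_eq by auto
next
  fix x' assume x': "x \<le> x' \<and> ((real x', real y) \<in> modified_diagonal D \<or> (x', y) = bounce_end D)"
  have "decs D (y - 1) \<le> decs D y" by (cases y) (auto simp: decs_Suc)
  then show "y - decs D y \<le> x'" using x' unfolding modified_diagonal_points bounce_end_eq by auto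
qed

text \<open>The height at which the bounce path leaves the vertical line through its diagonal point
  at height \<open>y\<close>; as an index from 0, it is the first row of the next block. The value
  \<open>n\<close> at the end keeps the iteration stationary.\<close>

definition next_row :: "nat \<Rightarrow> nat" where
  "next_row y = (if y < n then LEAST j. y < j \<and> (j = n \<or> y - decs D y < red_col D j) else n)"

lemma next_row_props:
  assumes "y < n"
  shows "y < next_row y" "next_row y \<le> n" "next_row y = n \<or> y - decs D y < red_col D (next_row y)"
    "\<And>j. y < j \<Longrightarrow> j < next_row y \<Longrightarrow> red_col D j \<le> y - decs D y"
proof -
  let ?P = "\<lambda>j. y < j \<and> (j = n \<or> y - decs D y < red_col D j)"
  have nr: "next_row y = (LEAST j. ?P j)" using assms by (simp add: next_row_def)
  have "?P n" using assms by simp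
  then have "?P (next_row y)" unfolding nr by (rule LeastI)
  then show "y < next_row y" "next_row y = n \<or> y - decs D y < red_col D (next_row y)" by auto
  show "next_row y \<le> n" unfolding nr by (rule Least_le) (use assms in simp)
  show "red_col D j \<le> y - decs D y" if "y < j" "j < next_row y" for j
    using not_less_Least[of j ?P] that unfolding nr by auto
qed

lemma north_stop_eq:
  assumes "y \<le> n"
  shows "north_stop D (y - decs D y) y = next_row y"
proof (cases "y < n")
  case False
  then have y: "y = n" using assms by simp
  show ?thesis unfolding north_stop_def y next_row_def
    by (simp, rule Least_equality) (auto simp: bounce_end_eq)
next
  case True
  note nr = next_row_props[OF True]
  show ?thesis unfolding north_stop_def
  proof (rule Least_equality)
    obtain j where j: "next_row y = Suc j" using nr(1) by (cases "next_row y") auto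
    have "red_col D j \<le> y - decs D y"
    proof (cases "j = y")
      case True then show ?thesis using red_col_le[of y] assms by simp
    next
      case False then show ?thesis using nr(4)[of j] nr(1) j by auto
    qed
    moreover have "y - decs D y < red_col D (next_row y)"
      using nr(3) red_col_n diag_less_n[OF True] by auto
    ultimately show "y \<le> next_row y \<and> ((y - decs D y, next_row y) \<in> east_step_starts (reduced_path D) \<or> (y - decs D y, next_row y) = bounce_end D)"
      using nr j unfolding reduced_starts by auto
  next
    fix h assume h: "y \<le> h \<and> ((y - decs D y, h) \<in> east_step_starts (reduced_path D) \<or> (y - decs D y, h) = bounce_end D)"
    show "next_row y \<le> h"
    proof (rule ccontr)
      assume less: "\<not> next_row y \<le> h"
      then have "h < n" using nr(2) by simp
      then have "(y - decs D y, h) \<in> east_step_starts (reduced_path D)" using h bounce_end_eq by auto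
      then have "y - decs D y < red_col D h" unfolding reduced_starts by auto
      moreover have "red_col D h \<le> y - decs D y"
        using red_col_le[of y] nr(4)[of h] h less assms by (cases "h = y") auto
      ultimately show False by simp
    qed
  qed
qed

lemma next_row_le: "y \<le> n \<Longrightarrow> y \<le> next_row y \<and> next_row y \<le> n"
  using next_row_props(1,2)[of y] by (cases "y < n") (auto simp: next_row_def)

lemma bounce_point_eq:
  "bounce_point D k = ((next_row ^^ k) 0 - decs D ((next_row ^^ k) 0), (next_row ^^ k) 0) \<and> (next_row ^^ k) 0 \<le> n"
proof (induction k)
  case 0
  then show ?case by simp
next
  case (Suc k)
  let ?y = "(next_row ^^ k) 0"
  have "?y \<le> next_row ?y" "next_row ?y \<le> n" using next_row_le Suc by auto
  then show ?case using Suc by (simp add: Let_def north_stop_eq east_stop_eq diag_mono)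
qed

text \<open>The accumulator counts the rows from index \<open>y\<close> to \<open>j - 1\<close>
  without decorated peak. As \<open>red_col D j\<close> is \<open>j\<close> minus the area of that
  row minus \<open>decs D j\<close>, the test \<open>w < s\<close> is precisely
  \<open>y - decs D y < red_col D j\<close>, the condition in \<open>next_row\<close>.\<close>

lemma rows_bounce_step:
  assumes y: "y < n" and j: "y < j" "j \<le> next_row y"
  shows "rows_bounce ((j - decs D j) - (y - decs D y)) (map (row_of D) [j..<n])
     = (n - next_row y) + rows_bounce 0 (map (row_of D) [next_row y..<n])"
  using j(2,1)
proof (induction j rule: inc_induct)
  case base
  note nr = next_row_props[OF y]
  show ?case
  proof (cases "next_row y = n")
    case False
    let ?j = "next_row y"
    have j: "?j < n" using False nr by simp
    have "?j - cols (path D) ! ?j < (?j - decs D ?j) - (y - decs D y)"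
      using nr False decs_le_cols[of ?j] DD(3)[of ?j] j by (auto simp: red_col_def)
    moreover have "[?j..<n] = ?j # [Suc ?j..<n]" using j by (rule upt_conv_Cons)
    ultimately show ?thesis using j DD(1) by (simp add: row_of_def area_word_eq)
  qed simp
next
  case (step j)
  note nr = next_row_props[OF y]
  have j: "j < n" using step nr by simp
  have le: "red_col D j \<le> y - decs D y" using nr(4) step by simp
  have "\<not> j - cols (path D) ! j < (j - decs D j) - (y - decs D y)"
    using le decs_le_cols[of j] DD(3)[of j] j by (auto simp: red_col_def)
  moreover have "[j..<n] = j # [Suc j..<n]" using j by (rule upt_conv_Cons)
  moreover have "(j - decs D j) - (y - decs D y) + of_bool (Suc j \<notin> Peak D) = (Suc j - decs D (Suc j)) - (y - decs D y)"
    using diag_mono[of y j] decs_le[of j] step j by (auto simp: decs_Suc)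
  ultimately show ?case using step j DD(1) by (simp add: row_of_def area_word_eq)
qed

lemma rows_bounce_block:
  assumes "y \<le> n"
  shows "rows_bounce 0 (map (row_of D) [y..<n]) = (n - next_row y) + rows_bounce 0 (map (row_of D) [next_row y..<n])"
proof (cases "y < n")
  case True
  have "[y..<n] = y # [Suc y..<n]" using True by (rule upt_conv_Cons)
  moreover have "(Suc y - decs D (Suc y)) - (y - decs D y) = of_bool (Suc y \<notin> Peak D)"
    using decs_le[of y] True by (auto simp: decs_Suc)
  ultimately have "rows_bounce 0 (map (row_of D) [y..<n]) = rows_bounce ((Suc y - decs D (Suc y)) - (y - decs D y)) (map (row_of D) [Suc y..<n])"
    by (simp add: row_of_def)
  then show ?thesis using rows_bounce_step[OF True, of "Suc y"] next_row_props(1)[OF True] by simp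
qed (use assms in \<open>simp add: next_row_def\<close>)

lemma rows_bounce_eq_second_bounce: "rows_bounce 0 (map (row_of D) [0..<n]) = second_bounce D"
proof -
  define Y where "Y k = (next_row ^^ k) 0" for k
  have Y: "Y k \<le> n" "Y k \<le> Y (Suc k)" "Y k < n \<Longrightarrow> Y k < Y (Suc k)" for k
    using bounce_point_eq[of k] next_row_le[of "Y k"] next_row_props(1)[of "Y k"] by (auto simp: Y_def)
  \<comment> \<open>Every step below \<open>n\<close> is strict, so \<open>n\<close> iterations
    reach the end, in agreement with the range of \<open>k\<close> in
    \<open>second_bounce\<close>.\<close>
  have "min n k \<le> Y k" for k
  proof (induction k)
    case (Suc k) then show ?case using Y(2,3)[of k] by (cases "Y k < n") auto
  qed simp
  from this[of n] have Yn: "Y n = n" using Y(1)[of n] by simp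
  have rb: "rows_bounce 0 (map (row_of D) [0..<n]) = (\<Sum>k<m. n - Y (Suc k)) + rows_bounce 0 (map (row_of D) [Y m..<n])" for m
  proof (induction m)
    case (Suc m) then show ?case using rows_bounce_block[OF Y(1)[of m]] by (simp add: Y_def)
  qed (simp add: Y_def)
  \<comment> \<open>Summation by parts: giving label \<open>k\<close> to the \<open>k\<close>-th run
    is the same as adding one, at each turn, to all rows above it.\<close>
  have abel: "(\<Sum>k<m. k * (Y (Suc k) - Y k)) + m * (n - Y m) = (\<Sum>k<m. n - Y (Suc k))" for m
  proof (induction m)
    case (Suc m)
    have "n - Y m = (Y (Suc m) - Y m) + (n - Y (Suc m))" using Y(1)[of "Suc m"] Y(2)[of m] by simp
    then have "m * (n - Y m) = m * (Y (Suc m) - Y m) + m * (n - Y (Suc m))"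
      by (simp only: add_mult_distrib2)
    then show ?case using Suc.IH by simp
  qed simp
  have "second_bounce D = (\<Sum>k<n. k * (Y (Suc k) - Y k))"
    unfolding second_bounce_def DD(4)
  proof (rule sum.cong[OF refl])
    fix k
    have "snd (bounce_point D k) = Y k" for k using bounce_point_eq[of k] by (simp add: Y_def)
    then show "(\<Sum>r\<in>{snd (bounce_point D k)<..snd (bounce_point D (Suc k))}. k) = k * (Y (Suc k) - Y k)"
      by (simp del: bounce_point.simps)
  qed
  then show ?thesis using rb[of n] abel[of n] Yn by simp
qed

end

section \<open>The correspondence with row lists\<close>

lemma valid_rows_map:
  "valid_rows H pv (map (\<lambda>j. (w j, st j, mk j)) [i..<n]) \<longleftrightarrow>
     (if i < n then w i \<le> H \<and> (mk i \<longrightarrow> pv \<and> w i = H) \<and> \<not> st (n - 1) \<and>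
        (\<forall>j. i \<le> j \<and> Suc j < n \<longrightarrow> w (Suc j) \<le> w j + of_bool (\<not> st j) \<and>
            (mk (Suc j) \<longrightarrow> \<not> st j \<and> w (Suc j) = w j + of_bool (\<not> st j)))
      else pv)"
proof (induction "n - i" arbitrary: i H pv)
  case 0
  then show ?case by simp
next
  case (Suc m)
  then have i: "i < n" and m: "m = n - Suc i" by auto
  have ex: "(\<forall>j. i \<le> j \<and> Suc j < n \<longrightarrow> P j) \<longleftrightarrow> (Suc i < n \<longrightarrow> P i) \<and> (\<forall>j. Suc i \<le> j \<and> Suc j < n \<longrightarrow> P j)" for P
    by (metis Suc_leD Suc_leI le_neq_implies_less order_refl)
  have "[i..<n] = i # [Suc i..<n]" using i by (rule upt_conv_Cons)
  then have "valid_rows H pv (map (\<lambda>j. (w j, st j, mk j)) [i..<n]) \<longleftrightarrow>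
    w i \<le> H \<and> (mk i \<longrightarrow> pv \<and> w i = H) \<and>
    valid_rows (w i + of_bool (\<not> st i)) (\<not> st i) (map (\<lambda>j. (w j, st j, mk j)) [Suc i..<n])"
    by simp
  also have "\<dots> \<longleftrightarrow> w i \<le> H \<and> (mk i \<longrightarrow> pv \<and> w i = H) \<and> \<not> st (n - 1) \<and>
        (\<forall>j. i \<le> j \<and> Suc j < n \<longrightarrow> w (Suc j) \<le> w j + of_bool (\<not> st j) \<and>
            (mk (Suc j) \<longrightarrow> \<not> st j \<and> w (Suc j) = w j + of_bool (\<not> st j)))"
  proof (cases "Suc i < n")
    case True
    then show ?thesis unfolding Suc.hyps(1)[OF m] ex[of "\<lambda>j. w (Suc j) \<le> w j + of_bool (\<not> st j) \<and>
            (mk (Suc j) \<longrightarrow> \<not> st j \<and> w (Suc j) = w j + of_bool (\<not> st j))"] by auto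
  next
    case False
    then have "n = Suc i" using i by simp
    then show ?thesis by auto
  qed
  finally show ?case using i by simp
qed

definition rows_of :: "nat \<Rightarrow> decorated_path \<Rightarrow> row list" where
  "rows_of n D = map (row_of D) [0..<n]"

lemma length_rows_of [simp]: "length (rows_of n D) = n"
  by (simp add: rows_of_def)

lemma nth_rows_of: "j < n \<Longrightarrow> rows_of n D ! j = row_of D j"
  by (simp add: rows_of_def)

lemma Rise_less:
  assumes "D \<in> decorated_dyck_bar n a b" "i \<in> Rise D"
  shows "0 < i" "i < n"
proof -
  note DD = decorated_dyck_barD[OF assms(1)]
  obtain j where "i = Suc j" using assms(2) DD(6) rises_subset[of "path D"] by blast
  then show "0 < i" "i < n" using assms(2) DD(1,6) rises_iff[of j "path D"] by auto
qed

text \<open>A decorated rise \<open>j\<close> discounts row \<open>j + 1\<close>, which has list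
  index \<open>j\<close>; this explains the different shifts for \<open>Peak\<close> and
  \<open>Rise\<close> in \<open>row_of\<close>.\<close>

lemma rows_area_eq_area:
  assumes D: "D \<in> decorated_dyck_bar n a b"
  shows "int (rows_area (rows_of n D)) = area D"
proof -
  note DD = decorated_dyck_barD[OF D]
  have R: "Rise D \<subseteq> {..<n}" using Rise_less(2)[OF D] by blast
  have "rows_area (rows_of n D) = (\<Sum>j<n. if j \<in> Rise D then 0 else area_word (path D) (Suc j))"
    unfolding rows_area_def rows_of_def
    by (simp add: o_def row_of_def interv_sum_list_conv_sum_set_nat atLeast0LessThan)
  then have "int (rows_area (rows_of n D)) = (\<Sum>j<n. int (area_word (path D) (Suc j)) - (if j \<in> Rise D then int (area_word (path D) (Suc j)) else 0))"
    by (simp only: of_nat_sum) (intro sum.cong refl, simp)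
  also have "\<dots> = (\<Sum>j<n. int (area_word (path D) (Suc j))) - (\<Sum>j<n. if j \<in> Rise D then int (area_word (path D) (Suc j)) else 0)"
    by (rule sum_subtractf)
  also have "(\<Sum>j<n. if j \<in> Rise D then int (area_word (path D) (Suc j)) else 0) = (\<Sum>j\<in>Rise D. int (area_word (path D) (j + 1)))"
    using R by (simp add: sum.If_cases inf_absorb2)
  also have "(\<Sum>j<n. int (area_word (path D) (Suc j))) = (\<Sum>i = 1..n. int (area_word (path D) i))"
    unfolding image_Suc_lessThan[symmetric] by (simp add: sum.reindex)
  finally show ?thesis by (simp add: area_def DD(4))
qed

lemma area_word_cols:
  assumes "D \<in> decorated_dyck_bar n a b" "j < n"
  shows "area_word (path D) (Suc j) + cols (path D) ! j = j"
  using decorated_dyck_barD(1,3)[OF assms(1)] assms(2) by (simp add: area_word_eq)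

text \<open>Since area and column of index \<open>j\<close> add up to \<open>j\<close>, the bound on
  the next area says that columns increase weakly, and strictly after a decorated peak; a rise is
  the case of equal columns.\<close>

lemma rows_of_row_lists:
  assumes D: "D \<in> decorated_dyck_bar n a b" and n: "n \<ge> 1"
  shows "rows_of n D \<in> row_lists n 0 False" "starred (rows_of n D) = a" "marked (rows_of n D) = b"
proof -
  note DD = decorated_dyck_barD[OF D]
  note aw = area_word_cols[OF D]
  have "area_word (path D) (Suc 0) = 0" using aw[of 0] n by simp
  moreover have "0 \<notin> Rise D" using Rise_less(1)[OF D] by blast
  moreover have "Suc (n - 1) \<notin> Peak D" using DD(7) n by simp
  moreover have "area_word (path D) (Suc (Suc j)) \<le> area_word (path D) (Suc j) + of_bool (Suc j \<notin> Peak D)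
      \<and> (Suc j \<in> Rise D \<longrightarrow> Suc j \<notin> Peak D \<and> area_word (path D) (Suc (Suc j)) = area_word (path D) (Suc j) + of_bool (Suc j \<notin> Peak D))"
    if j: "Suc j < n" for j
  proof -
    have c: "cols (path D) ! j + of_bool (Suc j \<in> Peak D) \<le> cols (path D) ! Suc j"
      using cols_Suc[OF D, of j] j by simp
    have "Suc j \<in> Rise D \<Longrightarrow> cols (path D) ! j = cols (path D) ! Suc j"
      using DD(6) rises_iff[of j "path D"] by auto
    then show ?thesis using c aw[of j] aw[of "Suc j"] j by (cases "Suc j \<in> Peak D") auto
  qed
  ultimately show "rows_of n D \<in> row_lists n 0 False"
    using n unfolding row_lists_def rows_of_def row_of_def by (simp add: valid_rows_map)
  have "Peak D = Suc ` {j. j < n \<and> Suc j \<in> Peak D}"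
  proof (intro set_eqI iffI)
    fix i assume "i \<in> Peak D"
    then show "i \<in> Suc ` {j. j < n \<and> Suc j \<in> Peak D}" using DD(12)[of i] by (cases i) auto
  qed auto
  then have "card (Peak D) = card {j. j < n \<and> Suc j \<in> Peak D}"
    by (metis card_image inj_Suc)
  moreover have "starred (rows_of n D) = card {j. j < n \<and> Suc j \<in> Peak D}"
    unfolding starred_def length_filter_conv_card length_rows_of
    by (intro arg_cong[of _ _ card] Collect_cong) (auto simp: nth_rows_of row_of_def)
  ultimately show "starred (rows_of n D) = a" using DD(8) by simp
  have "Rise D = {j. j < n \<and> j \<in> Rise D}" using Rise_less(2)[OF D] by blast
  moreover have "marked (rows_of n D) = card {j. j < n \<and> j \<in> Rise D}"
    unfolding marked_def length_filter_conv_card length_rows_of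
    by (intro arg_cong[of _ _ card] Collect_cong) (auto simp: nth_rows_of row_of_def)
  ultimately show "marked (rows_of n D) = b" using DD(9) by simp
qed

lemma inj_rows_of: "inj_on (rows_of n) (decorated_dyck_bar n a b)"
proof (rule inj_onI)
  fix D D' assume D: "D \<in> decorated_dyck_bar n a b" and D': "D' \<in> decorated_dyck_bar n a b"
    and eq: "rows_of n D = rows_of n D'"
  have r: "row_of D j = row_of D' j" if "j < n" for j
    using eq nth_rows_of[OF that] by metis
  note DD = decorated_dyck_barD[OF D] and DD' = decorated_dyck_barD[OF D']
  have "north_cols (path D) = north_cols (path D')"
  proof (rule nth_equalityI)
    fix j assume "j < length (north_cols (path D))"
    then have j: "j < n" using DD(1) by simp
    then have "cols (path D) ! j = cols (path D') ! j"
      using area_word_cols[OF D j] area_word_cols[OF D' j] r[OF j] by (simp add: row_of_def)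
    then show "north_cols (path D) ! j = north_cols (path D') ! j"
      using j DD(1) DD'(1) by (simp add: cols_def nth_append)
  qed (use DD(1) DD'(1) in simp)
  then have "path D = path D'" by (rule path_unique) (use DD(2) DD'(2) in simp)
  moreover have "Peak D = Peak D'"
  proof (intro set_eqI)
    fix i
    show "i \<in> Peak D \<longleftrightarrow> i \<in> Peak D'"
    proof (cases "0 < i \<and> i < n")
      case True
      then have "i - 1 < n" "Suc (i - 1) = i" by auto
      then show ?thesis using r[of "i - 1"] unfolding row_of_def by (metis Pair_inject)
    next
      case False then show ?thesis using DD(12) DD'(12) by blast
    qed
  qed
  moreover have "Rise D = Rise D'"
  proof (intro set_eqI)
    fix i
    show "i \<in> Rise D \<longleftrightarrow> i \<in> Rise D'"
    proof (cases "i < n")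
      case True
      then show ?thesis using r[of i] by (simp add: row_of_def)
    next
      case False then show ?thesis using Rise_less(2)[OF D] Rise_less(2)[OF D'] by blast
    qed
  qed
  ultimately show "D = D'" by (cases D; cases D') simp
qed

lemma rows_of_surj:
  assumes rs: "rs \<in> row_lists n 0 False" and n: "n \<ge> 1"
  shows "\<exists>a b. \<exists>D \<in> decorated_dyck_bar n a b. rows_of n D = rs"
proof -
  define w st mk where "w j = fst (rs ! j)" and "st j = fst (snd (rs ! j))" and "mk j = snd (snd (rs ! j))" for j
  have len: "length rs = n" using rs by (simp add: row_lists_def)
  have rs_map: "rs = map (\<lambda>j. (w j, st j, mk j)) [0..<n]"
    using len by (intro nth_equalityI) (auto simp: w_def st_def mk_def)
  have "valid_rows 0 False (map (\<lambda>j. (w j, st j, mk j)) [0..<n])"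
    using rs unfolding rs_map[symmetric] by (simp add: row_lists_def)
  then have valid: "w 0 = 0" "\<not> mk 0" "\<not> st (n - 1)"
      "\<And>j. Suc j < n \<Longrightarrow> w (Suc j) \<le> w j + of_bool (\<not> st j)"
      "\<And>j. Suc j < n \<Longrightarrow> mk (Suc j) \<Longrightarrow> \<not> st j \<and> w (Suc j) = w j + 1"
    using n unfolding valid_rows_map by auto
  have wj: "w j \<le> j" if "j < n" for j
    using that
  proof (induction j)
    case (Suc j) then show ?case using valid(4)[of j] by (cases "st j") auto
  qed (simp add: valid(1))
  \<comment> \<open>The columns are recovered from the areas; \<open>wj\<close> ensures that no
    subtraction truncates.\<close>
  define xs where "xs = map (\<lambda>j. j - w j) [0..<n]"
  have "sorted xs"
    unfolding sorted_iff_nth_Suc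
  proof (intro allI impI)
    fix j assume "Suc j < length xs"
    then have "Suc j < n" by (simp add: xs_def)
    then show "xs ! j \<le> xs ! Suc j" using valid(4)[of j] by (cases "st j") (auto simp: xs_def)
  qed
  moreover have "\<forall>x\<in>set xs. x \<le> n" by (auto simp: xs_def)
  ultimately obtain p where p: "north_cols p = xs" "easts p = n" using path_exists by blast
  have N: "norths p = n" using length_north_cols[of p] p(1) by (simp add: xs_def)
  have cols: "cols p ! j = j - w j" if "j < n" for j
    using that p(1) by (simp add: cols_def nth_append xs_def)
  have cols_n: "cols p ! n = n" using cols_last[of p] N p(2) by simp
  have dyck: "dyck_path n p" unfolding dyck_path_iff
    using N p(2) cols cols_n by (auto simp: le_less)
  define D where "D = \<lparr>path = p, Peak = Suc ` {j. j < n \<and> st j}, Rise = {j. j < n \<and> mk j}\<rparr>"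
  have st_less: "Suc j < n" if "j < n" "st j" for j
    using that valid(3) by (cases "Suc j = n") auto
  have "Peak D \<subseteq> peaks p"
  proof
    fix i assume "i \<in> Peak D"
    then obtain j where j: "i = Suc j" "j < n" "st j" by (auto simp: D_def)
    then have "Suc j < n" using st_less by blast
    then show "i \<in> peaks p"
      using j valid(4)[of j] wj[of j] N by (auto simp: peaks_iff cols)
  qed
  moreover have "Rise D \<subseteq> rises p"
  proof
    fix i assume i: "i \<in> Rise D"
    then have "i \<noteq> 0" using valid(2) by (auto simp: D_def intro: ccontr)
    then obtain j where j: "i = Suc j" by (cases i) auto
    then have "Suc j < n" "mk (Suc j)" using i by (auto simp: D_def)
    then show "i \<in> rises p"
      using j valid(5)[of j] wj[of j] N by (auto simp: rises_iff cols)
  qed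
  moreover have "n \<notin> Peak D" using valid(3) by (auto simp: D_def)
  ultimately have D: "D \<in> decorated_dyck_bar n (card (Peak D)) (card (Rise D))"
    using dyck by (simp add: decorated_dyck_bar_def decorated_dyck_def) (simp add: D_def)
  have "rows_of n D = rs"
  proof (rule nth_equalityI)
    fix j assume "j < length (rows_of n D)"
    then have j: "j < n" by simp
    have "area_word p (Suc j) = w j" using j wj[of j] N by (simp add: area_word_eq cols)
    then have "row_of D j = (w j, st j, mk j)" using j by (auto simp: row_of_def D_def)
    then show "rows_of n D ! j = rs ! j" using j by (simp add: nth_rows_of w_def st_def mk_def)
  qed (simp add: len)
  then show ?thesis using D by blast
qed

lemma bij_rows_of:
  assumes n: "n \<ge> 1"
  shows "bij_betw (rows_of n) (decorated_dyck_bar n a b)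
     {rs \<in> row_lists n 0 False. starred rs = a \<and> marked rs = b}"
  unfolding bij_betw_def
proof (intro conjI inj_rows_of set_eqI iffI)
  fix rs assume "rs \<in> rows_of n ` decorated_dyck_bar n a b"
  then show "rs \<in> {rs \<in> row_lists n 0 False. starred rs = a \<and> marked rs = b}"
    using rows_of_row_lists[OF _ n] by auto
next
  fix rs assume rs: "rs \<in> {rs \<in> row_lists n 0 False. starred rs = a \<and> marked rs = b}"
  then obtain a' b' D where D: "D \<in> decorated_dyck_bar n a' b'" "rows_of n D = rs"
    using rows_of_surj[OF _ n] by blast
  then have "a' = a" "b' = b" using rows_of_row_lists(2,3)[OF D(1) n] rs by auto
  then show "rs \<in> rows_of n ` decorated_dyck_bar n a b" using D by blast
qed

theorem theorem2p4:
  fixes n a b :: nat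
  assumes "n \<ge> 1"
  shows "\<exists>\<psi> :: decorated_path \<Rightarrow> decorated_path.
           bij_betw \<psi> (decorated_dyck_bar n a b) (decorated_dyck_bar n b a) \<and>
           (\<forall>D \<in> decorated_dyck_bar n a b.
              area D = area (\<psi> D) \<and> second_bounce D = second_bounce (\<psi> D))"
proof -
  let ?S = "\<lambda>D. (area D, second_bounce D)"
  let ?rows = "\<lambda>a b. {rs \<in> row_lists n 0 False. starred rs = a \<and> marked rs = b}"
  have stats: "area D = int (rows_area (rows_of n D))" "second_bounce D = rows_bounce 0 (rows_of n D)"
    if "D \<in> decorated_dyck_bar n c d" for D c d
    using rows_area_eq_area[OF that] rows_bounce_eq_second_bounce[OF that] by (auto simp: rows_of_def)
  have fin: "finite (decorated_dyck_bar n c d)" for c d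
    using bij_betw_finite[OF bij_rows_of[OF assms, of c d]] finite_row_lists[of n 0 False] by simp
  have card: "card {D \<in> decorated_dyck_bar n c d. ?S D = (\<alpha>, \<beta>)}
     = card {rs \<in> ?rows c d. int (rows_area rs) = \<alpha> \<and> rows_bounce 0 rs = \<beta>}" for c d \<alpha> \<beta>
  proof -
    note bij = bij_rows_of[OF assms, of c d]
    have "rows_of n ` {D \<in> decorated_dyck_bar n c d. ?S D = (\<alpha>, \<beta>)}
       = {rs \<in> ?rows c d. int (rows_area rs) = \<alpha> \<and> rows_bounce 0 rs = \<beta>}"
    proof -
      have "?S D = (\<alpha>, \<beta>) \<longleftrightarrow> int (rows_area (rows_of n D)) = \<alpha> \<and> rows_bounce 0 (rows_of n D) = \<beta>"
        if "D \<in> decorated_dyck_bar n c d" for D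
        unfolding stats[OF that] by simp
      then show ?thesis unfolding bij_betw_imp_surj_on[OF bij, symmetric] by blast
    qed
    moreover have "card (rows_of n ` {D \<in> decorated_dyck_bar n c d. ?S D = (\<alpha>, \<beta>)})
       = card {D \<in> decorated_dyck_bar n c d. ?S D = (\<alpha>, \<beta>)}"
      by (rule card_image, rule inj_on_subset[OF bij_betw_imp_inj_on[OF bij]]) blast
    ultimately show ?thesis by simp
  qed
  have sym: "card {rs \<in> ?rows a b. int (rows_area rs) = \<alpha> \<and> rows_bounce 0 rs = \<beta>}
     = card {rs \<in> ?rows b a. int (rows_area rs) = \<alpha> \<and> rows_bounce 0 rs = \<beta>}" for \<alpha> \<beta>
  \<comment> \<open>The area is an integer by definition but a natural number on row lists, so
    negative values have empty fibres on both sides.\<close>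
  proof (cases "\<alpha> \<ge> 0")
    case True
    then obtain k where "\<alpha> = int k" using nonneg_int_cases by blast
    have "{rs \<in> ?rows c d. int (rows_area rs) = \<alpha> \<and> rows_bounce 0 rs = \<beta>}
      = {rs \<in> row_lists n 0 False. rows_area rs = k \<and> rows_bounce 0 rs = \<beta> \<and> starred rs = c \<and> marked rs = d}" for c d
      unfolding \<open>\<alpha> = int k\<close> by auto
    then show ?thesis by (simp only: card_row_lists_symmetric[of n k \<beta> a b])
  next
    case False
    then have "int m \<noteq> \<alpha>" for m by auto
    then show ?thesis by simp
  qed
  have "card {D \<in> decorated_dyck_bar n a b. ?S D = v} = card {D \<in> decorated_dyck_bar n b a. ?S D = v}" for v
    by (cases v) (simp only: card sym)
  from bij_betw_of_card_fibres[OF fin fin this] obtain \<psi> where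
    "bij_betw \<psi> (decorated_dyck_bar n a b) (decorated_dyck_bar n b a)"
    "\<And>D. D \<in> decorated_dyck_bar n a b \<Longrightarrow> ?S (\<psi> D) = ?S D"
    by blast
  then show ?thesis by (intro exI[of _ \<psi>]) simp
qed

end
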